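(* For any fixed real number $\alpha$ with $1/4\le \alpha\le 1$ and sufficiently large $n$, $$r(B_{\lceil \alpha n\rceil}, B_n)=(\sqrt{\alpha}+1)^2 n+o(n),$$ where $o(n)$ denotes a quantity whose ratio to $n$ tends to $0$ as $n\to\infty$ with $\alpha$ fixed.
   Context: For graphs $G$ and $H$, the Ramsey number $r(G,H)$ is the smallest positive integer $N$ such that any red/blue edge coloring of the complete graph $K_N$ contains either a red copy of $G$ or a blue copy of $H$ (as a not necessarily induced subgraph). The book $B_m$ is the graph consisting of $m$ triangles all sharing a common edge (so it has $m+2$ vertices). The paper omits ceiling signs, writing $B_{\alpha n}$ for $B_{\lceil\alpha n\rceil}$. *)

theory Defs
  imports Complex_Main "HOL-Library.Ramsey" "HOL-Library.Landau_Symbols"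
begin

section \<open>Graphs and copies\<close>

datatype 'a graph = Graph (verts: "'a set") (edges: "'a set set")

definition finite_simple_graph :: "'a graph \<Rightarrow> bool" where
  "finite_simple_graph G \<longleftrightarrow> finite (verts G) \<and> edges G \<subseteq> nsets (verts G) 2"

definition complete_graph :: "nat \<Rightarrow> nat graph" where
  "complete_graph N = Graph {..<N} (nsets {..<N} 2)"

text \<open>A copy is a subgraph, not necessarily induced: non-edges of \<open>G\<close> are unconstrained.\<close>

definition contains_copy :: "'b graph \<Rightarrow> 'a graph \<Rightarrow> bool" where
  "contains_copy K G \<longleftrightarrow>
     (\<exists>f. inj_on f (verts G) \<and> f ` verts G \<subseteq> verts K \<and> (\<forall>e\<in>edges G. f ` e \<in> edges K))"

text \<open>\<open>B\<^sub>m\<close>: the shared edge is \<open>{0, 1}\<close>, and each of the \<open>m\<close> vertices \<open>2, \<dots>, m + 1\<close> spans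
  a triangle with it.\<close>

definition book :: "nat \<Rightarrow> nat graph" where
  "book m = Graph {..<m + 2} (insert {0, 1} (\<Union>i\<in>{2..<m + 2}. {{0, i}, {1, i}}))"

section \<open>Ramsey numbers\<close>

datatype colour = Red | Blue

text \<open>Colourings are total functions; only their values on edges are ever inspected.\<close>

definition colour_class :: "'a graph \<Rightarrow> ('a set \<Rightarrow> colour) \<Rightarrow> colour \<Rightarrow> 'a graph" where
  "colour_class K c x = Graph (verts K) {e \<in> edges K. c e = x}"

definition ramsey_property :: "'a graph \<Rightarrow> 'b graph \<Rightarrow> nat \<Rightarrow> bool" where
  "ramsey_property G H N \<longleftrightarrow>
     (\<forall>c. contains_copy (colour_class (complete_graph N) c Red) G \<or>
          contains_copy (colour_class (complete_graph N) c Blue) H)"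

definition ramsey_number :: "'a graph \<Rightarrow> 'b graph \<Rightarrow> nat" where
  "ramsey_number G H = (LEAST N. N > 0 \<and> ramsey_property G H N)"

text \<open>The minimum above is attained for all finite simple graphs, in particular for books.\<close>

lemma contains_copy_of_clique:
  assumes G: "finite_simple_graph G"
    and R: "R \<subseteq> verts K" "finite R" "card R = card (verts G)" "nsets R 2 \<subseteq> edges K"
  shows "contains_copy K G"
proof -
  obtain f where f: "bij_betw f (verts G) R"
    using G R finite_same_card_bij unfolding finite_simple_graph_def by metis
  have "f ` e \<in> edges K" if "e \<in> edges G" for e
  proof -
    have "e \<in> nsets (verts G) 2" using that G by (auto simp: finite_simple_graph_def)
    then have "f ` e \<in> nsets R 2" using bij_betw_nsets[OF f, of 2] by (auto simp: bij_betw_def)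
    then show ?thesis using R by blast
  qed
  then show ?thesis
    using f R unfolding contains_copy_def bij_betw_def by blast
qed

lemma ramsey_property_exists:
  assumes G: "finite_simple_graph G" and H: "finite_simple_graph H"
  shows "\<exists>N>0. ramsey_property G H N"
proof -
  obtain N :: nat where N: "N \<ge> 1"
    and r: "\<And>(V :: nat set) E. finite V \<Longrightarrow> card V \<ge> N \<Longrightarrow>
      \<exists>R\<subseteq>V. card R = card (verts G) \<and> clique R E \<or> card R = card (verts H) \<and> indep R E"
    using ramsey2[of "card (verts G)" "card (verts H)"] by metis
  have "ramsey_property G H N"
    unfolding ramsey_property_def
  proof (rule allI)
    fix c :: "nat set \<Rightarrow> colour"
    obtain R where R: "R \<subseteq> {..<N}"
      and d: "card R = card (verts G) \<and> clique R {e. c e = Red} \<or>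
              card R = card (verts H) \<and> indep R {e. c e = Red}"
      using r[of "{..<N}" "{e. c e = Red}"] by auto
    have fin: "finite R" using R finite_subset by blast
    have sub: "nsets R 2 \<subseteq> nsets {..<N} 2" using R by (rule nsets_mono)
    from d show "contains_copy (colour_class (complete_graph N) c Red) G \<or>
                 contains_copy (colour_class (complete_graph N) c Blue) H"
    proof
      assume a: "card R = card (verts G) \<and> clique R {e. c e = Red}"
      have "c e = Red" if "e \<in> nsets R 2" for e
        using that a by (auto simp: clique_def elim!: nsets2_E)
      then have "contains_copy (colour_class (complete_graph N) c Red) G"
        using R a fin sub
        by (intro contains_copy_of_clique[OF G, of R])
           (auto simp: colour_class_def complete_graph_def)
      then show ?thesis ..
    next
      assume a: "card R = card (verts H) \<and> indep R {e. c e = Red}"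
      have "c e = Blue" if "e \<in> nsets R 2" for e
        using that a by (cases "c e") (auto simp: indep_def elim!: nsets2_E)
      then have "contains_copy (colour_class (complete_graph N) c Blue) H"
        using R a fin sub
        by (intro contains_copy_of_clique[OF H, of R])
           (auto simp: colour_class_def complete_graph_def)
      then show ?thesis ..
    qed
  qed
  with N show ?thesis by (intro exI[of _ N]) auto
qed

lemma finite_simple_graph_book: "finite_simple_graph (book m)"
  by (auto simp: finite_simple_graph_def book_def)

lemma ramsey_number_works:
  assumes "finite_simple_graph G" "finite_simple_graph H"
  shows "ramsey_number G H > 0 \<and> ramsey_property G H (ramsey_number G H)"
  using LeastI_ex[OF ramsey_property_exists[OF assms]] by (simp add: ramsey_number_def)

end

theory Submission
  imports Defs "HOL-Analysis.Convex"
begin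

text \<open>
  A colouring contains a red \<open>B\<^sub>m\<close> iff some red edge has at least \<open>m\<close> common red neighbours, and
  likewise for blue.  In a random colouring of \<open>N\<close> vertices with red density \<open>p\<close> these codegrees are
  about \<open>p\<^sup>2 N\<close> and \<open>(1 - p)\<^sup>2 N\<close>.  Equating them with \<open>\<alpha> n\<close> and \<open>n\<close> gives
  \<open>N = (\<surd>\<alpha> + 1)\<^sup>2 n\<close> and \<open>p = \<surd>\<alpha> / (\<surd>\<alpha> + 1)\<close>; the range of \<open>\<alpha>\<close> means \<open>1 / 3 \<le> p \<le> 1 / 2\<close>.

  The lower bound needs a colouring in which no codegree exceeds its random value by much
  (\<open>exists_balanced_colouring\<close>).  It is found by rounding: a sum of exponential moments of the
  codegrees is affine in every edge variable, so all edges can be moved from \<open>p\<close> to \<open>0\<close> or \<open>1\<close>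
  without increasing it.

  For the upper bound suppose that every red codegree on a red edge is below \<open>p\<^sup>2 N\<close> and every blue
  one on a blue edge below \<open>(1 - p)\<^sup>2 N\<close>, by a margin.  Almost all vertices are covered by boundedly
  many disjoint cells such that codegrees are nearly constant between any two cells and inside
  each of them (\<open>concentrated_cells\<close>, by an energy increment).  Let \<open>d\<^sub>Y \<in> [0, 1]\<^sup>N\<close> be the average
  red neighbourhood of the cell \<open>Y\<close>.  If a positive proportion of the pairs between \<open>Y\<close> and \<open>Z\<close> is
  red, then \<open>\<langle>d\<^sub>Y, d\<^sub>Z\<rangle> < p\<^sup>2\<close> in the normalised inner product; if a positive proportion is blue, then
  \<open>\<langle>1 - d\<^sub>Y, 1 - d\<^sub>Z\<rangle> < (1 - p)\<^sup>2\<close>.  This also applies to \<open>Y = Z\<close>, so every cell is of red or of blue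
  type.  Two quadratic inequalities, which use \<open>p \<le> 1 / 2\<close> and \<open>1 / 3 \<le> p\<close>, show that cells of red
  type are joined almost only in red and that no three cells of blue type are pairwise joined in red.
  Consequently, up to small errors, the red part has measure less than \<open>p\<^sup>2\<close>, and some blue
  cell is joined only in blue to half of the blue part, which has measure less than \<open>2 (1 - p)\<^sup>2\<close> (\<open>cell_configuration\<close>).  But
  \<open>p\<^sup>2 + 2 (1 - p)\<^sup>2 \<le> 1\<close> for \<open>1 / 3 \<le> p \<le> 1\<close>, a contradiction.
\<close>

section \<open>Books and monochromatic codegrees\<close>

definition common_nbrs :: "nat \<Rightarrow> (nat set \<Rightarrow> colour) \<Rightarrow> colour \<Rightarrow> nat \<Rightarrow> nat \<Rightarrow> nat set" where
  "common_nbrs N c x u v = {w. w < N \<and> w \<noteq> u \<and> w \<noteq> v \<and> c {u, w} = x \<and> c {v, w} = x}"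

lemma finite_common_nbrs [simp]: "finite (common_nbrs N c x u v)"
  by (simp add: common_nbrs_def)

lemma edge_colour_class_iff:
  "{u, v} \<in> edges (colour_class (complete_graph N) c x)
    \<longleftrightarrow> u < N \<and> v < N \<and> u \<noteq> v \<and> c {u, v} = x"
  by (auto simp: colour_class_def complete_graph_def nsets_def card_insert_if)

lemma contains_book_iff:
  "contains_copy (colour_class (complete_graph N) c x) (book m) \<longleftrightarrow>
    (\<exists>u<N. \<exists>v<N. u \<noteq> v \<and> c {u, v} = x \<and> m \<le> card (common_nbrs N c x u v))"
  (is "?L \<longleftrightarrow> ?R")
proof
  assume ?L
  then obtain f where "inj_on f (verts (book m))"
    and E: "\<And>e. e \<in> edges (book m) \<Longrightarrow> f ` e \<in> edges (colour_class (complete_graph N) c x)"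
    unfolding contains_copy_def by blast
  then have inj: "inj_on f {..<m + 2}" by (simp add: book_def)
  have spine: "{f 0, f 1} \<in> edges (colour_class (complete_graph N) c x)"
    using E[of "{0, 1}"] by (simp add: book_def)
  have "f i \<in> common_nbrs N c x (f 0) (f 1)" if "i \<in> {2..<m + 2}" for i
  proof -
    have "{f 0, f i} \<in> edges (colour_class (complete_graph N) c x)"
      "{f 1, f i} \<in> edges (colour_class (complete_graph N) c x)"
      using E[of "{0, i}"] E[of "{1, i}"] that unfolding book_def by fastforce+
    then show ?thesis
      unfolding edge_colour_class_iff common_nbrs_def by auto
  qed
  then have "f ` {2..<m + 2} \<subseteq> common_nbrs N c x (f 0) (f 1)" by auto
  moreover have "card (f ` {2..<m + 2}) = m"
    by (subst card_image[OF inj_on_subset[OF inj]]) auto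
  ultimately have "m \<le> card (common_nbrs N c x (f 0) (f 1))"
    by (metis card_mono finite_common_nbrs)
  with spine show ?R unfolding edge_colour_class_iff by blast
next
  assume ?R
  then obtain u v where uv: "u < N" "v < N" "u \<noteq> v" "c {u, v} = x"
    and m: "m \<le> card (common_nbrs N c x u v)" by blast
  obtain T where T: "T \<subseteq> common_nbrs N c x u v" "card T = m" "finite T"
    using obtain_subset_with_card_n[OF m] by blast
  obtain g where g: "bij_betw g {2..<m + 2} T"
    using finite_same_card_bij[of "{2..<m + 2}" T] T by auto
  define f where "f i = (if i = 0 then u else if i = 1 then v else g i)" for i :: nat
  have gT: "g i \<in> common_nbrs N c x u v" if "2 \<le> i" "i < m + 2" for i
    using g T that unfolding bij_betw_def by auto
  have "inj_on f {..<m + 2}"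
  proof (rule linorder_inj_onI')
    fix i j assume ij: "i \<in> {..<m + 2}" "j \<in> {..<m + 2}" "i < j"
    consider "i = 0" "j = 1" | "i \<le> 1" "2 \<le> j" | "2 \<le> i" using ij by linarith
    then show "f i \<noteq> f j"
    proof cases
      case 1
      then show ?thesis using uv by (simp add: f_def)
    next
      case 2
      then have "g j \<in> common_nbrs N c x u v" using gT ij by simp
      then have "g j \<noteq> u" "g j \<noteq> v" by (simp_all add: common_nbrs_def)
      then show ?thesis using 2 by (simp add: f_def)
    next
      case 3
      then have "g i \<noteq> g j" using inj_onD[OF bij_betw_imp_inj_on[OF g], of i j] ij by auto
      then show ?thesis using 3 ij by (simp add: f_def)
    qed
  qed
  moreover have "f ` {..<m + 2} \<subseteq> {..<N}"
    using uv gT by (auto simp: f_def common_nbrs_def) 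
  moreover have "f ` e \<in> edges (colour_class (complete_graph N) c x)" if e: "e \<in> edges (book m)" for e
  proof -
    consider "e = {0, 1}" | i where "2 \<le> i" "i < m + 2" "e = {0, i} \<or> e = {1, i}"
      using e unfolding book_def by auto
    then show ?thesis
    proof cases
      case 1
      then have "f ` e = {u, v}" by (auto simp: f_def)
      then show ?thesis using uv by (simp add: edge_colour_class_iff)
    next
      case 2
      then have "f ` e = {u, g i} \<or> f ` e = {v, g i}" by (auto simp: f_def)
      then show ?thesis
        using gT[of i] 2 uv by (auto simp: common_nbrs_def edge_colour_class_iff)
    qed
  qed
  moreover have "verts (book m) = {..<m + 2}" "verts (colour_class (complete_graph N) c x) = {..<N}"
    by (simp_all add: book_def colour_class_def complete_graph_def)
  ultimately show ?L
    unfolding contains_copy_def by (intro exI[of _ f]) simp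
qed

lemma ramsey_property_book_iff:
  "ramsey_property (book m) (book n) N \<longleftrightarrow>
    (\<forall>c. \<exists>u<N. \<exists>v<N. u \<noteq> v \<and>
      (c {u, v} = Red \<and> m \<le> card (common_nbrs N c Red u v) \<or>
       c {u, v} = Blue \<and> n \<le> card (common_nbrs N c Blue u v)))"
  unfolding ramsey_property_def contains_book_iff by (intro all_cong1) blast

lemma ramsey_property_book_mono:
  assumes "ramsey_property (book m) (book n) M" "M \<le> N"
  shows "ramsey_property (book m) (book n) N"
proof -
  have le: "card (common_nbrs M c x u v) \<le> card (common_nbrs N c x u v)" for c x u v
    using assms(2) by (intro card_mono) (auto simp: common_nbrs_def)
  show ?thesis
    unfolding ramsey_property_book_iff
  proof
    fix c
    obtain u v where uv: "u < M" "v < M" "u \<noteq> v"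
      and "c {u, v} = Red \<and> m \<le> card (common_nbrs M c Red u v) \<or>
        c {u, v} = Blue \<and> n \<le> card (common_nbrs M c Blue u v)"
      using assms(1) unfolding ramsey_property_book_iff by blast
    then have "c {u, v} = Red \<and> m \<le> card (common_nbrs N c Red u v) \<or>
        c {u, v} = Blue \<and> n \<le> card (common_nbrs N c Blue u v)"
      using le[of c _ u v] le_trans by blast
    moreover have "u < N" "v < N" using uv assms(2) by auto
    ultimately show "\<exists>u<N. \<exists>v<N. u \<noteq> v \<and>
      (c {u, v} = Red \<and> m \<le> card (common_nbrs N c Red u v) \<or>
       c {u, v} = Blue \<and> n \<le> card (common_nbrs N c Blue u v))"
      using uv(3) by blast
  qed
qed

section \<open>Balanced colourings and the lower bound\<close>

text \<open>This is the method of conditional expectations without a probability space: a function that is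
  affine in one coordinate takes at an interior point a value between those at the two ends, so
  each coordinate can be pushed to \<open>0\<close> or \<open>1\<close> in turn without increasing it.\<close>

lemma multiaffine_rounding:
  fixes F :: "('e \<Rightarrow> real) \<Rightarrow> real"
  assumes aff: "\<And>x e t. e \<in> E \<Longrightarrow> F (x(e := t)) = (1 - t) * F (x(e := 0)) + t * F (x(e := 1))"
    and fin: "finite E" and x: "\<And>e. e \<in> E \<Longrightarrow> 0 \<le> x e \<and> x e \<le> 1"
  shows "\<exists>y. (\<forall>e\<in>E. y e = 0 \<or> y e = 1) \<and> F y \<le> F x"
proof -
  have "\<exists>y. (\<forall>e\<in>D. y e = 0 \<or> y e = 1) \<and> (\<forall>e. e \<notin> D \<longrightarrow> y e = x e) \<and> F y \<le> F x"
    if "finite D" "D \<subseteq> E" for D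
    using that
  proof (induction D rule: finite_induct)
    case empty
    then show ?case by auto
  next
    case (insert e D)
    then obtain y where y: "\<forall>e\<in>D. y e = 0 \<or> y e = 1" "\<forall>e. e \<notin> D \<longrightarrow> y e = x e" "F y \<le> F x"
      by auto
    have t: "0 \<le> y e" "y e \<le> 1" using x[of e] y insert by auto
    have eq: "F y = (1 - y e) * F (y(e := 0)) + y e * F (y(e := 1))"
      using aff[of e y "y e"] insert by simp
    have "F (y(e := 0)) \<le> F y \<or> F (y(e := 1)) \<le> F y"
    proof (rule ccontr)
      assume "\<not> ?thesis"
      then have less: "- F (y(e := 0)) < - F y" "- F (y(e := 1)) < - F y" by auto
      have "(1 - y e) * (- F (y(e := 0))) + y e * (- F (y(e := 1))) < - F y"
        using t by (intro convex_bound_lt[OF less]) auto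
      then show False using eq by simp
    qed
    then obtain b where b: "b = 0 \<or> b = 1" "F (y(e := b)) \<le> F y" by blast
    have "F (y(e := b)) \<le> F x" using b y by simp
    then show ?case
      using b(1) y insert by (intro exI[of _ "y(e := b)"]) (simp del: fun_upd_apply, auto)
  qed
  from this[OF fin order_refl] show ?thesis by blast
qed

text \<open>For \<open>0/1\<close>-valued \<open>y\<close> the product is \<open>(1 + s)\<close> to the number of common neighbours of
  \<open>u\<close> and \<open>v\<close> in the graph with edge indicator \<open>y\<close>, and for \<open>y\<close> constantly \<open>p\<close> it is the moment
  generating function of that number in a random graph.  Leaving out \<open>u\<close> and \<open>v\<close> makes every edge
  occur in at most one factor.\<close>

definition pair_potential :: "nat \<Rightarrow> real \<Rightarrow> nat \<Rightarrow> nat \<Rightarrow> (nat set \<Rightarrow> real) \<Rightarrow> real" where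
  "pair_potential N s u v y = (\<Prod>w\<in>{..<N} - {u, v}. 1 + s * y {u, w} * y {v, w})"

lemma pair_potential_commute: "pair_potential N s u v y = pair_potential N s v u y"
  unfolding pair_potential_def by (simp add: insert_commute mult_ac)

text \<open>An edge \<open>{u, w}\<close> or \<open>{v, w}\<close> influences the factor of \<open>w\<close> only, and that factor is affine in it.\<close>

lemma pair_potential_affine:
  assumes "u \<noteq> v"
  shows "pair_potential N s u v (y(e := t)) =
    (1 - t) * pair_potential N s u v (y(e := 0)) + t * pair_potential N s u v (y(e := 1))"
proof -
  have key: "pair_potential N s u v (y({u, w} := t)) =
      (1 - t) * pair_potential N s u v (y({u, w} := 0)) + t * pair_potential N s u v (y({u, w} := 1))"
    if w: "w \<in> {..<N} - {u, v}" and "u \<noteq> v" for u v w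
  proof -
    have other: "(y({u, w} := t')) {u, w'} = y {u, w'}" "(y({u, w} := t')) {v, w'} = y {v, w'}"
      if "w' \<in> {..<N} - {u, v} - {w}" for w' t'
      using that w \<open>u \<noteq> v\<close> by (auto simp: doubleton_eq_iff)
    have vw: "(y({u, w} := t')) {v, w} = y {v, w}" for t'
      using w \<open>u \<noteq> v\<close> by (auto simp: doubleton_eq_iff)
    have "pair_potential N s u v (y({u, w} := t')) = (1 + s * t' * y {v, w}) *
        (\<Prod>w'\<in>{..<N} - {u, v} - {w}. 1 + s * y {u, w'} * y {v, w'})" for t'
    proof -
      have "(\<Prod>w'\<in>{..<N} - {u, v} - {w}. 1 + s * (y({u, w} := t')) {u, w'} * (y({u, w} := t')) {v, w'}) =
          (\<Prod>w'\<in>{..<N} - {u, v} - {w}. 1 + s * y {u, w'} * y {v, w'})"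
        by (rule prod.cong) (simp_all only: other)
      then show ?thesis
        unfolding pair_potential_def by (subst prod.remove[OF _ w]) (simp_all only: vw fun_upd_same finite_Diff finite_lessThan)
    qed
    then show ?thesis by (simp add: algebra_simps)
  qed
  consider w where "w \<in> {..<N} - {u, v}" "e = {u, w}" | w where "w \<in> {..<N} - {u, v}" "e = {v, w}"
    | "\<forall>w\<in>{..<N} - {u, v}. e \<noteq> {u, w} \<and> e \<noteq> {v, w}" by blast
  then show ?thesis
  proof cases
    case 1
    then show ?thesis using key assms by simp
  next
    case 2
    then show ?thesis using key[of w v u] assms
      by (simp add: pair_potential_commute[of N s u v] insert_commute)
  next
    case 3
    then have "pair_potential N s u v (y(e := t')) = pair_potential N s u v y" for t'
      unfolding pair_potential_def by (intro prod.cong) auto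
    then show ?thesis by (simp add: algebra_simps)
  qed
qed

lemma pair_potential_integral:
  assumes "\<And>w. w < N \<Longrightarrow> w \<noteq> u \<Longrightarrow> y {u, w} = of_bool (c {u, w} = x)"
    "\<And>w. w < N \<Longrightarrow> w \<noteq> v \<Longrightarrow> y {v, w} = of_bool (c {v, w} = x)"
  shows "pair_potential N s u v y = (1 + s) ^ card (common_nbrs N c x u v)"
proof -
  have "pair_potential N s u v y =
      (\<Prod>w\<in>{..<N} - {u, v}. if w \<in> common_nbrs N c x u v then 1 + s else 1)"
    unfolding pair_potential_def using assms
    by (intro prod.cong) (auto simp: common_nbrs_def)
  also have "\<dots> = (\<Prod>w\<in>({..<N} - {u, v}) \<inter> common_nbrs N c x u v. 1 + s)"
    by (rule prod.inter_restrict[symmetric]) simp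
  also have "({..<N} - {u, v}) \<inter> common_nbrs N c x u v = common_nbrs N c x u v"
    by (auto simp: common_nbrs_def)
  finally show ?thesis by simp
qed

lemma pair_potential_const_le:
  assumes "0 \<le> s"
  shows "pair_potential N s u v (\<lambda>_. p) \<le> exp (s * p\<^sup>2 * N)"
proof -
  have "pair_potential N s u v (\<lambda>_. p) = (1 + s * p\<^sup>2) ^ card ({..<N} - {u, v})"
    by (simp add: pair_potential_def power2_eq_square mult.assoc)
  also have "\<dots> \<le> (1 + s * p\<^sup>2) ^ N"
    using assms card_mono[of "{..<N}" "{..<N} - {u, v}"] by (intro power_increasing) auto
  also have "\<dots> \<le> exp (s * p\<^sup>2) ^ N"
    using assms by (intro power_mono) auto
  also have "\<dots> = exp (s * p\<^sup>2 * N)"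
    by (simp add: exp_of_nat_mult mult.commute)
  finally show ?thesis .
qed

lemma eventually_quadratic_exp_less_1:
  assumes "0 < (a :: real)"
  shows "eventually (\<lambda>N :: nat. 2 * (real N)\<^sup>2 * exp (- a * real N) < 1) sequentially"
proof -
  have "filterlim (\<lambda>N. a * real N) at_top sequentially"
    by (rule filterlim_tendsto_pos_mult_at_top[OF tendsto_const assms filterlim_real_sequentially])
  then have "((\<lambda>N. (a * real N) ^ 2 / exp (a * real N)) \<longlongrightarrow> 0) sequentially"
    by (rule filterlim_compose[OF tendsto_power_div_exp_0])
  then have "((\<lambda>N. 2 / a\<^sup>2 * ((a * real N) ^ 2 / exp (a * real N))) \<longlongrightarrow> 2 / a\<^sup>2 * 0) sequentially"
    by (intro tendsto_mult tendsto_const)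
  moreover have "2 / a\<^sup>2 * ((a * real N) ^ 2 / exp (a * real N)) = 2 * (real N)\<^sup>2 * exp (- a * real N)" for N
    using assms by (simp add: power_mult_distrib exp_minus field_simps)
  ultimately have "((\<lambda>N. 2 * (real N)\<^sup>2 * exp (- a * real N)) \<longlongrightarrow> 0) sequentially" by simp
  then show ?thesis by (rule order_tendstoD(2)) simp
qed

text \<open>The colouring that a random choice with red density \<open>p\<close> yields.  The potential adds up, over all
  pairs and both colours, the exponential moments whose size bounds the upper tails of the
  codegrees.  At the constant point \<open>p\<close> it is below \<open>1\<close> by the Chernoff computation; rounding all
  edges to \<open>0\<close> or \<open>1\<close> keeps it there, and then no single summand can belong to a large codegree.\<close>

lemma exists_balanced_colouring:
  fixes p \<gamma> :: real
  assumes p: "0 \<le> p" "p \<le> 1" and \<gamma>: "0 < \<gamma>"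
  shows "eventually (\<lambda>N. \<exists>c. \<forall>u<N. \<forall>v<N. u \<noteq> v \<longrightarrow>
    card (common_nbrs N c Red u v) \<le> (p\<^sup>2 + \<gamma>) * N \<and>
    card (common_nbrs N c Blue u v) \<le> ((1 - p)\<^sup>2 + \<gamma>) * N) sequentially"
proof -
  define \<delta> where "\<delta> = min \<gamma> 1"
  have \<delta>: "0 < \<delta>" "\<delta> \<le> 1" "\<delta> \<le> \<gamma>" using \<gamma> by (auto simp: \<delta>_def)
  \<comment> \<open>This \<open>\<tau>\<close> minimises \<open>\<tau>\<^sup>2-\<tau>\<delta>\<close>, a bound
    on the Chernoff exponent.\<close>
  define \<tau> where "\<tau> = \<delta> / 2"
  define s where "s = exp \<tau> - 1"
  have s: "0 \<le> s" "s \<le> \<tau> + \<tau>\<^sup>2"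
    using \<delta> exp_bound[of \<tau>] by (auto simp: s_def \<tau>_def)
  have "\<exists>c. \<forall>u<N. \<forall>v<N. u \<noteq> v \<longrightarrow>
      card (common_nbrs N c Red u v) \<le> (p\<^sup>2 + \<gamma>) * N \<and>
      card (common_nbrs N c Blue u v) \<le> ((1 - p)\<^sup>2 + \<gamma>) * N"
    if small: "2 * (real N)\<^sup>2 * exp (- (\<delta>\<^sup>2 / 4) * real N) < 1" for N :: nat
  proof -
    define wt where "wt r u v y = exp (- \<tau> * (r\<^sup>2 + \<delta>) * N) * pair_potential N s u v y"
      for r u v y
    define D where "D = {(u, v). u < N \<and> v < N \<and> u \<noteq> v}"
    define F where "F y = (\<Sum>(u, v)\<in>D. wt p u v y + wt (1 - p) u v (\<lambda>e. 1 - y e))" for y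
    have D: "D \<subseteq> {..<N} \<times> {..<N}" by (auto simp: D_def)
    then have finD: "finite D" by (rule finite_subset) auto
    have start: "wt r u v (\<lambda>_. r) \<le> exp (- (\<delta>\<^sup>2 / 4) * N)" if "0 \<le> r" "r \<le> 1" for r u v
    proof -
      have r2: "r\<^sup>2 \<le> 1" "0 \<le> r\<^sup>2" using that by (auto intro: power_le_one)
      have "s * r\<^sup>2 \<le> (\<tau> + \<tau>\<^sup>2) * r\<^sup>2" using s r2 by (intro mult_right_mono) auto
      also have "\<dots> \<le> \<tau> * r\<^sup>2 + \<tau>\<^sup>2" using r2 by (simp add: algebra_simps mult_left_le)
      finally have "s * r\<^sup>2 - \<tau> * (r\<^sup>2 + \<delta>) \<le> - (\<delta>\<^sup>2 / 4)"
        by (simp add: \<tau>_def algebra_simps power2_eq_square)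
      then have le: "(s * r\<^sup>2 - \<tau> * (r\<^sup>2 + \<delta>)) * N \<le> - (\<delta>\<^sup>2 / 4) * N"
        by (rule mult_right_mono) simp
      have "wt r u v (\<lambda>_. r) \<le> exp (- \<tau> * (r\<^sup>2 + \<delta>) * N) * exp (s * r\<^sup>2 * N)"
        unfolding wt_def by (intro mult_left_mono pair_potential_const_le s) simp
      also have "\<dots> = exp ((s * r\<^sup>2 - \<tau> * (r\<^sup>2 + \<delta>)) * N)"
        by (simp add: exp_add[symmetric] algebra_simps)
      also have "\<dots> \<le> exp (- (\<delta>\<^sup>2 / 4) * N)" using le by simp
      finally show ?thesis .
    qed
    have "F (\<lambda>_. p) \<le> (\<Sum>(u, v)\<in>D. 2 * exp (- (\<delta>\<^sup>2 / 4) * N))"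
      unfolding F_def case_prod_beta mult_2 by (intro sum_mono add_mono start) (use p in auto)
    also have "\<dots> = card D * (2 * exp (- (\<delta>\<^sup>2 / 4) * N))" by simp
    also have "\<dots> \<le> (real N)\<^sup>2 * (2 * exp (- (\<delta>\<^sup>2 / 4) * N))"
      using card_mono[OF _ D] by (intro mult_right_mono) (auto simp: power2_eq_square simp flip: of_nat_mult)
    finally have F_start: "F (\<lambda>_. p) < 1" using small by simp
    have aff: "F (y(e := t)) = (1 - t) * F (y(e := 0)) + t * F (y(e := 1))" for y e t
    proof -
      have flip: "(\<lambda>e'. 1 - (y(e := t')) e') = (\<lambda>e'. 1 - y e')(e := 1 - t')" for t' by auto
      have red: "wt p u v (y(e := t)) = (1 - t) * wt p u v (y(e := 0)) + t * wt p u v (y(e := 1))"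
        if "u \<noteq> v" for u v
        unfolding wt_def by (subst pair_potential_affine[OF that]) (simp add: algebra_simps)
      have blue: "wt (1 - p) u v (\<lambda>e'. 1 - (y(e := t)) e') =
          (1 - t) * wt (1 - p) u v (\<lambda>e'. 1 - (y(e := 0)) e') +
          t * wt (1 - p) u v (\<lambda>e'. 1 - (y(e := 1)) e')"
        if "u \<noteq> v" for u v
        unfolding flip wt_def by (subst pair_potential_affine[OF that]) (simp add: algebra_simps)
      show ?thesis
        unfolding F_def sum_distrib_left sum.distrib[symmetric]
        by (intro sum.cong refl) (auto simp: D_def red blue algebra_simps simp del: fun_upd_apply)
    qed
    obtain y where y: "\<And>e. e \<in> nsets {..<N} 2 \<Longrightarrow> y e = 0 \<or> y e = 1" and "F y \<le> F (\<lambda>_. p)"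
      using multiaffine_rounding[of "nsets {..<N} 2" F "\<lambda>_. p"] aff p finite_imp_finite_nsets
      by (metis finite_lessThan)
    with F_start have F_y: "F y < 1" by simp
    define c where "c e = (if y e = 1 then Red else Blue)" for e
    have red_y: "y {u, w} = of_bool (c {u, w} = Red)"
      and blue_y: "1 - y {u, w} = of_bool (c {u, w} = Blue)" if "u < N" "w < N" "w \<noteq> u" for u w
      using y[of "{u, w}"] that by (auto simp: c_def nsets_def)
    have wt_red: "wt r u v y = exp (\<tau> * (card (common_nbrs N c Red u v) - (r\<^sup>2 + \<delta>) * N))"
      and wt_blue: "wt r u v (\<lambda>e. 1 - y e) =
        exp (\<tau> * (card (common_nbrs N c Blue u v) - (r\<^sup>2 + \<delta>) * N))"
      if "u < N" "v < N" for u v r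
    proof -
      have pow: "(1 + s) ^ k = exp (\<tau> * k)" for k
        by (simp add: s_def exp_of_nat_mult[symmetric] mult.commute)
      show "wt r u v y = exp (\<tau> * (card (common_nbrs N c Red u v) - (r\<^sup>2 + \<delta>) * N))"
        unfolding wt_def
        by (subst pair_potential_integral[where c = c and x = Red])
          (use red_y that in \<open>auto simp: pow exp_add[symmetric] algebra_simps\<close>)
      show "wt r u v (\<lambda>e. 1 - y e) =
          exp (\<tau> * (card (common_nbrs N c Blue u v) - (r\<^sup>2 + \<delta>) * N))"
        unfolding wt_def
        by (subst pair_potential_integral[where c = c and x = Blue])
          (use blue_y that in \<open>auto simp: pow exp_add[symmetric] algebra_simps\<close>)
    qed
    have small_card: "real k \<le> (r\<^sup>2 + \<gamma>) * N" if "exp (\<tau> * (k - (r\<^sup>2 + \<delta>) * N)) < 1" for k r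
    proof -
      have "k < (r\<^sup>2 + \<delta>) * N"
        using that \<delta> by (simp add: \<tau>_def mult_less_0_iff)
      also have "\<dots> \<le> (r\<^sup>2 + \<gamma>) * N" using \<delta> by (intro mult_right_mono) auto
      finally show ?thesis by simp
    qed
    have "card (common_nbrs N c Red u v) \<le> (p\<^sup>2 + \<gamma>) * N \<and>
      card (common_nbrs N c Blue u v) \<le> ((1 - p)\<^sup>2 + \<gamma>) * N"
      if uv: "u < N" "v < N" "u \<noteq> v" for u v
    proof -
      have nonneg: "0 \<le> wt p u' v' y + wt (1 - p) u' v' (\<lambda>e. 1 - y e)" if "(u', v') \<in> D" for u' v'
        using that by (auto simp: D_def wt_red wt_blue intro: add_nonneg_nonneg)
      have "wt p u v y + wt (1 - p) u v (\<lambda>e. 1 - y e) \<le> F y"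
        unfolding F_def using member_le_sum[of "(u, v)" D
          "\<lambda>(u, v). wt p u v y + wt (1 - p) u v (\<lambda>e. 1 - y e)"] nonneg finD uv
        by (auto simp: D_def)
      then have "exp (\<tau> * (card (common_nbrs N c Red u v) - (p\<^sup>2 + \<delta>) * N)) +
          exp (\<tau> * (card (common_nbrs N c Blue u v) - ((1 - p)\<^sup>2 + \<delta>) * N)) < 1"
        using F_y uv by (simp add: wt_red wt_blue)
      then have "exp (\<tau> * (card (common_nbrs N c Red u v) - (p\<^sup>2 + \<delta>) * N)) < 1"
        "exp (\<tau> * (card (common_nbrs N c Blue u v) - ((1 - p)\<^sup>2 + \<delta>) * N)) < 1"
        by (smt (verit) exp_gt_zero)+
      then show ?thesis using small_card by blast
    qed
    then show ?thesis by blast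
  qed
  moreover have "0 < \<delta>\<^sup>2 / 4" using \<delta> by simp
  ultimately show ?thesis
    using eventually_quadratic_exp_less_1[of "\<delta>\<^sup>2 / 4"] by (auto elim: eventually_mono)
qed

section \<open>Concentrated sets of vectors\<close>

definition ip :: "'w set \<Rightarrow> ('w \<Rightarrow> real) \<Rightarrow> ('w \<Rightarrow> real) \<Rightarrow> real" where
  "ip W f g = (\<Sum>w\<in>W. f w * g w) / card W"

definition mean :: "'v set \<Rightarrow> ('v \<Rightarrow> 'w \<Rightarrow> real) \<Rightarrow> 'w \<Rightarrow> real" where
  "mean Y x w = (\<Sum>v\<in>Y. x v w) / card Y"

abbreviation unit_on :: "'w set \<Rightarrow> ('w \<Rightarrow> real) \<Rightarrow> bool" where
  "unit_on W f \<equiv> \<forall>w\<in>W. 0 \<le> f w \<and> f w \<le> 1"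

text \<open>The inner products of the vectors in \<open>Y\<close> with any fixed test vector are, on average, close to
  that of their mean.  The test vectors range over all of \<open>[0, 1]\<^sup>W\<close>, so that neighbourhoods of
  vertices and means of other sets are covered at once.\<close>

definition concentrated :: "'w set \<Rightarrow> ('v \<Rightarrow> 'w \<Rightarrow> real) \<Rightarrow> real \<Rightarrow> 'v set \<Rightarrow> bool" where
  "concentrated W x \<delta> Y \<longleftrightarrow>
    (\<forall>f. unit_on W f \<longrightarrow> (\<Sum>v\<in>Y. \<bar>ip W f (x v) - ip W f (mean Y x)\<bar>) \<le> \<delta> * card Y)"

lemma ip_commute: "ip W f g = ip W g f"
  by (simp add: ip_def mult.commute)

lemma ip_diff_right: "ip W f (\<lambda>w. g w - h w) = ip W f g - ip W f h"
  by (simp add: ip_def algebra_simps sum_subtractf diff_divide_distrib)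

lemma ip_nonneg: "unit_on W f \<Longrightarrow> unit_on W g \<Longrightarrow> 0 \<le> ip W f g"
  by (auto simp: ip_def intro!: divide_nonneg_nonneg sum_nonneg)

lemma ip_self_nonneg: "0 \<le> ip W f f"
  by (auto simp: ip_def intro!: divide_nonneg_nonneg sum_nonneg)

lemma ip_le_1:
  assumes "unit_on W f" "unit_on W g"
  shows "ip W f g \<le> 1"
proof -
  have "(\<Sum>w\<in>W. f w * g w) \<le> (\<Sum>w\<in>W. 1)"
    using assms by (intro sum_mono mult_le_one) auto
  then show ?thesis by (auto simp: ip_def intro!: divide_le_eq_1[THEN iffD2])
qed

lemma ip_Cauchy_Schwarz: "(ip W f g)\<^sup>2 \<le> ip W f f * ip W g g"
proof -
  have "(\<Sum>w\<in>W. f w * g w)\<^sup>2 \<le> (\<Sum>w\<in>W. (f w)\<^sup>2) * (\<Sum>w\<in>W. (g w)\<^sup>2)"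
    by (rule Cauchy_Schwarz_ineq_sum)
  then show ?thesis
    by (simp add: ip_def power_divide power2_eq_square divide_right_mono)
qed

lemma mean_unit:
  assumes "\<And>v. v \<in> Y \<Longrightarrow> unit_on W (x v)"
  shows "unit_on W (mean Y x)"
proof
  fix w assume "w \<in> W"
  then have "(\<Sum>v\<in>Y. x v w) \<le> (\<Sum>v\<in>Y. 1 :: real)" "0 \<le> (\<Sum>v\<in>Y. x v w)"
    using assms by (intro sum_mono sum_nonneg; blast)+
  then show "0 \<le> mean Y x w \<and> mean Y x w \<le> 1"
    by (auto simp: mean_def divide_le_eq_1)
qed

lemma sum_ip:
  assumes "finite Y" "Y \<noteq> {}"
  shows "(\<Sum>v\<in>Y. ip W f (x v)) = card Y * ip W f (mean Y x)"
proof -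
  have "(\<Sum>v\<in>Y. \<Sum>w\<in>W. f w * x v w) = (\<Sum>w\<in>W. f w * (\<Sum>v\<in>Y. x v w))"
    by (subst sum.swap) (simp add: sum_distrib_left)
  also have "\<dots> = card Y * (\<Sum>w\<in>W. f w * mean Y x w)"
    using assms by (simp add: mean_def sum_distrib_left[of "real (card Y)"])
  finally show ?thesis by (simp add: ip_def sum_divide_distrib[symmetric])
qed

text \<open>If a test vector \<open>f\<close> separates many members of \<open>Y\<close> from their mean, split \<open>Y\<close> by the sign of the
  deviation.  Both parts are large, since deviations are at most \<open>1\<close> and add up to zero.  The
  average squared length of the two means exceeds the squared length of the old mean by the
  variance between the parts, which Cauchy-Schwarz with \<open>f\<close> bounds from below; so one part
  has a longer mean.\<close>

lemma energy_increment:
  assumes x: "\<And>v. v \<in> Y \<Longrightarrow> unit_on W (x v)"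
    and Y: "finite Y" "Y \<noteq> {}" and \<delta>: "0 < \<delta>" and bad: "\<not> concentrated W x \<delta> Y"
  shows "\<exists>Z\<subseteq>Y. Z \<noteq> {} \<and> \<delta> / 2 * card Y \<le> card Z \<and>
    ip W (mean Y x) (mean Y x) + \<delta>\<^sup>2 / 4 \<le> ip W (mean Z x) (mean Z x)"
proof -
  define \<mu> where "\<mu> Z = mean Z x" for Z
  obtain f where f: "unit_on W f"
    and big: "\<delta> * card Y < (\<Sum>v\<in>Y. \<bar>ip W f (x v) - ip W f (\<mu> Y)\<bar>)"
    using bad unfolding concentrated_def \<mu>_def by (auto simp: not_le)
  define g where "g v = ip W f (x v) - ip W f (\<mu> Y)" for v
  define P where "P = {v \<in> Y. 0 < g v}"
  define Q where "Q = Y - P"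
  have PQ: "P \<subseteq> Y" "Q \<subseteq> Y" "finite P" "finite Q" "P \<inter> Q = {}" "P \<union> Q = Y"
    using Y by (auto simp: P_def Q_def)
  have split: "sum h Y = sum h P + sum h Q" for h :: "'a \<Rightarrow> real"
    using sum.union_disjoint[of P Q h] PQ by simp
  have "(\<Sum>v\<in>Y. g v) = 0"
    using Y by (simp add: g_def sum_subtractf sum_ip \<mu>_def)
  then have zero: "sum g P = - sum g Q" using split[of g] by simp
  have "(\<Sum>v\<in>Y. \<bar>g v\<bar>) = sum g P - sum g Q"
  proof -
    have "(\<Sum>v\<in>P. \<bar>g v\<bar>) = sum g P" by (intro sum.cong) (auto simp: P_def)
    moreover have "(\<Sum>v\<in>Q. \<bar>g v\<bar>) = (\<Sum>v\<in>Q. - g v)" by (intro sum.cong) (auto simp: P_def Q_def)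
    ultimately show ?thesis by (simp add: split sum_negf)
  qed
  then have gP: "\<delta> / 2 * card Y < sum g P" and gQ: "sum g Q < - (\<delta> / 2 * card Y)"
    using big zero by (auto simp: g_def[symmetric])
  have unitY: "unit_on W (\<mu> Y)" unfolding \<mu>_def using x by (rule mean_unit)
  have g1: "\<bar>g v\<bar> \<le> 1" if "v \<in> Y" for v
    using ip_le_1[OF f x[OF that]] ip_nonneg[OF f x[OF that]] ip_le_1[OF f unitY] ip_nonneg[OF f unitY]
    by (auto simp: g_def)
  have "g v \<le> 1" if "v \<in> P" for v using g1[of v] that PQ by auto
  moreover have "- g v \<le> 1" if "v \<in> Q" for v using g1[of v] that PQ by auto
  ultimately have "sum g P \<le> (\<Sum>v\<in>P. 1)" "(\<Sum>v\<in>Q. - g v) \<le> (\<Sum>v\<in>Q. 1)"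
    by (blast intro: sum_mono)+
  then have cP: "\<delta> / 2 * card Y < card P" and cQ: "\<delta> / 2 * card Y < card Q"
    using gP gQ by (auto simp: sum_negf)
  have ne: "P \<noteq> {}" "Q \<noteq> {}"
    using cP cQ \<delta> by (auto simp: mult_less_0_iff)
  define h where "h = (\<lambda>w. \<mu> P w - \<mu> Y w)"
  define k where "k = (\<lambda>w. \<mu> Q w - \<mu> Y w)"
  have cY: "real (card Y) = card P + card Q"
    using PQ card_Un_disjoint[of P Q] by simp
  \<comment> \<open>The displacements of the two partial means balance, so the linear terms of the expansion
    cancel.\<close>
  have bal: "card P * h w + card Q * k w = 0" for w
  proof -
    have "card Z * \<mu> Z w = (\<Sum>v\<in>Z. x v w)" if "finite Z" "Z \<noteq> {}" for Z
      using that by (simp add: \<mu>_def mean_def)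
    then have "card P * \<mu> P w + card Q * \<mu> Q w = card Y * \<mu> Y w"
      using PQ ne Y split[of "\<lambda>v. x v w"] by simp
    then show ?thesis by (simp add: h_def k_def cY algebra_simps)
  qed
  have "card P * ip W (\<mu> Y) h + card Q * ip W (\<mu> Y) k = (\<Sum>w\<in>W. \<mu> Y w * (card P * h w + card Q * k w)) / card W"
    by (simp add: ip_def algebra_simps sum_distrib_left sum.distrib add_divide_distrib)
  then have bal': "card P * ip W (\<mu> Y) h + card Q * ip W (\<mu> Y) k = 0" by (simp add: bal)
  have expand: "ip W (\<mu> Z) (\<mu> Z) = ip W (\<mu> Y) (\<mu> Y) + 2 * ip W (\<mu> Y) h' + ip W h' h'"
    if "h' = (\<lambda>w. \<mu> Z w - \<mu> Y w)" for Z h'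
    unfolding that ip_diff_right ip_commute[of W "\<lambda>w. \<mu> Z w - \<mu> Y w"]
    by (simp add: ip_commute)
  have fh: "card P * ip W f h = sum g P"
    unfolding h_def ip_diff_right
    using PQ ne by (simp add: g_def sum_subtractf sum_ip \<mu>_def right_diff_distrib)
  have gain: "card Y * (\<delta>\<^sup>2 / 4) \<le> card P * ip W h h"
  proof -
    have "(ip W f h)\<^sup>2 \<le> ip W f f * ip W h h" by (rule ip_Cauchy_Schwarz)
    also have "\<dots> \<le> 1 * ip W h h" using ip_le_1[OF f f] by (intro mult_right_mono ip_self_nonneg)
    finally have C: "(ip W f h)\<^sup>2 \<le> ip W h h" by simp
    have cp: "0 < real (card P)" "real (card P) \<le> card Y" using ne PQ Y by (auto simp: card_gt_0_iff card_mono)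
    have "(\<delta> / 2 * card Y)\<^sup>2 \<le> (card P * ip W f h)\<^sup>2"
      using gP \<delta> unfolding fh by (intro power_mono) auto
    also have "\<dots> \<le> (card P)\<^sup>2 * ip W h h"
      using C by (simp add: power_mult_distrib mult_left_mono)
    finally have "card Y * (card Y * (\<delta>\<^sup>2 / 4)) \<le> card P * (card P * ip W h h)"
      by (simp add: power2_eq_square algebra_simps)
    also have "\<dots> \<le> card Y * (card P * ip W h h)"
      using cp by (intro mult_right_mono mult_nonneg_nonneg ip_self_nonneg) auto
    finally show ?thesis using cp by (simp add: mult_le_cancel_left)
  qed
  have "card P * (ip W (\<mu> Y) (\<mu> Y) + \<delta>\<^sup>2 / 4) + card Q * (ip W (\<mu> Y) (\<mu> Y) + \<delta>\<^sup>2 / 4)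
      \<le> card P * ip W (\<mu> P) (\<mu> P) + card Q * ip W (\<mu> Q) (\<mu> Q)"
    unfolding expand[OF h_def] expand[OF k_def]
    using gain bal' mult_nonneg_nonneg[OF of_nat_0_le_iff[of "card Q"] ip_self_nonneg[of W k]]
    by (simp add: cY algebra_simps)
  moreover have "0 < real (card P)" "0 < real (card Q)"
    using ne PQ by (simp_all add: card_gt_0_iff)
  ultimately have "ip W (\<mu> Y) (\<mu> Y) + \<delta>\<^sup>2 / 4 \<le> ip W (\<mu> P) (\<mu> P) \<or>
      ip W (\<mu> Y) (\<mu> Y) + \<delta>\<^sup>2 / 4 \<le> ip W (\<mu> Q) (\<mu> Q)"
    by (meson add_strict_mono linorder_not_le mult_strict_left_mono)
  then show ?thesis
  proof
    assume "ip W (\<mu> Y) (\<mu> Y) + \<delta>\<^sup>2 / 4 \<le> ip W (\<mu> P) (\<mu> P)"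
    then show ?thesis using PQ(1) ne(1) cP unfolding \<mu>_def by (intro exI[of _ P]) simp
  next
    assume "ip W (\<mu> Y) (\<mu> Y) + \<delta>\<^sup>2 / 4 \<le> ip W (\<mu> Q) (\<mu> Q)"
    then show ?thesis using PQ(2) ne(2) cQ unfolding \<mu>_def by (intro exI[of _ Q]) simp
  qed
qed

text \<open>Mean vectors have length at most \<open>1\<close>, so the energy can grow only a bounded number of times;
  \<open>n\<close> counts the increments still possible.\<close>

lemma concentrated_subset_aux:
  fixes \<delta> :: real
  assumes \<delta>: "0 < \<delta>" "\<delta> \<le> 1"
  shows "\<lbrakk>\<And>v. v \<in> Y \<Longrightarrow> unit_on W (x v); finite Y; Y \<noteq> {};
      1 - n * (\<delta>\<^sup>2 / 4) < ip W (mean Y x) (mean Y x)\<rbrakk>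
    \<Longrightarrow> \<exists>Z\<subseteq>Y. Z \<noteq> {} \<and> (\<delta> / 2) ^ n * card Y \<le> card Z \<and> concentrated W x \<delta> Z"
proof (induction n arbitrary: Y)
  case 0
  have "unit_on W (mean Y x)" using 0(1) by (rule mean_unit)
  then show ?case using ip_le_1[of W "mean Y x" "mean Y x"] 0 by simp
next
  case (Suc n)
  show ?case
  proof (cases "concentrated W x \<delta> Y")
    case True
    have "(\<delta> / 2) ^ Suc n \<le> 1" using \<delta> by (intro power_le_one) auto
    then have "(\<delta> / 2) ^ Suc n * card Y \<le> 1 * real (card Y)" by (intro mult_right_mono) auto
    then show ?thesis using True Suc.prems by auto
  next
    case False
    obtain Z where Z: "Z \<subseteq> Y" "Z \<noteq> {}" "\<delta> / 2 * card Y \<le> card Z"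
      "ip W (mean Y x) (mean Y x) + \<delta>\<^sup>2 / 4 \<le> ip W (mean Z x) (mean Z x)"
      using energy_increment[OF Suc.prems(1-3) \<delta>(1) False] by blast
    have "\<exists>Z'\<subseteq>Z. Z' \<noteq> {} \<and> (\<delta> / 2) ^ n * card Z \<le> card Z' \<and> concentrated W x \<delta> Z'"
    proof (rule Suc.IH)
      show "finite Z" using Z Suc.prems finite_subset by blast
      show "1 - n * (\<delta>\<^sup>2 / 4) < ip W (mean Z x) (mean Z x)"
        using Z(4) Suc.prems(4) by (simp add: distrib_right add_divide_distrib)
    qed (use Z Suc.prems in auto)
    then obtain Z' where Z': "Z' \<subseteq> Z" "Z' \<noteq> {}" "(\<delta> / 2) ^ n * card Z \<le> card Z'"
      "concentrated W x \<delta> Z'" by blast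
    have "(\<delta> / 2) ^ n * (\<delta> / 2 * card Y) \<le> (\<delta> / 2) ^ n * card Z"
      using Z \<delta> by (intro mult_left_mono) auto
    then have "(\<delta> / 2) ^ Suc n * card Y \<le> card Z'" using Z'(3) by (simp add: algebra_simps)
    then show ?thesis using Z Z' by blast
  qed
qed

lemma concentrated_subset_exists:
  fixes \<delta> :: real
  assumes \<delta>: "0 < \<delta>" "\<delta> \<le> 1"
  shows "\<exists>\<kappa>::real. 0 < \<kappa> \<and> (\<forall>W x Y. (\<forall>v\<in>Y. unit_on W (x v)) \<longrightarrow> finite Y \<longrightarrow> Y \<noteq> {} \<longrightarrow>
    (\<exists>Z\<subseteq>Y. Z \<noteq> {} \<and> \<kappa> * card Y \<le> card Z \<and> concentrated W x \<delta> Z))"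
proof -
  obtain n :: nat where "1 / (\<delta>\<^sup>2 / 4) < n" using reals_Archimedean2 by blast
  then have n: "1 < n * (\<delta>\<^sup>2 / 4)" using \<delta> by (simp add: field_simps)
  have "\<exists>Z\<subseteq>Y. Z \<noteq> {} \<and> (\<delta> / 2) ^ n * card Y \<le> card Z \<and> concentrated W x \<delta> Z"
    if "\<forall>v\<in>Y. unit_on W (x v)" "finite Y" "Y \<noteq> {}" for W :: "'w set" and x and Y :: "'v set"
  proof (rule concentrated_subset_aux[OF \<delta>])
    show "1 - n * (\<delta>\<^sup>2 / 4) < ip W (mean Y x) (mean Y x)"
      using n ip_self_nonneg[of W "mean Y x"] by linarith
  qed (use that in auto)
  note main = this
  show ?thesis
  proof (intro exI[of _ "(\<delta> / 2) ^ n"] conjI allI impI)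
    show "0 < (\<delta> / 2) ^ n" using \<delta> by simp
  qed (rule main)
qed

text \<open>A regularity lemma for codegrees.  Concentrated sets of positive density can be split off one
  after the other until a \<open>\<delta>\<close>-fraction is left.  In contrast to a regular partition there are no
  exceptional pairs of cells, and a cell may be paired with itself; this is what
  allows every cell to be tested for its own colour.\<close>

lemma concentrated_cells:
  fixes \<delta> :: real
  assumes \<delta>: "0 < \<delta>" "\<delta> \<le> 1"
  shows "\<exists>\<kappa>::real. 0 < \<kappa> \<and> (\<forall>W (x :: 'v \<Rightarrow> 'w \<Rightarrow> real) V. finite V \<longrightarrow> (\<forall>v\<in>V. unit_on W (x v)) \<longrightarrow>
    (\<exists>\<C>. finite \<C> \<and> \<Union>\<C> \<subseteq> V \<and> pairwise disjnt \<C> \<and> card (V - \<Union>\<C>) \<le> \<delta> * card V \<and>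
      (\<forall>Y\<in>\<C>. Y \<noteq> {} \<and> \<kappa> * card V \<le> card Y \<and> concentrated W x \<delta> Y)))"
proof -
  obtain \<kappa> :: real where \<kappa>: "0 < \<kappa>" and sub: "\<And>W (x :: 'v \<Rightarrow> 'w \<Rightarrow> real) Y. \<lbrakk>\<forall>v\<in>Y. unit_on W (x v); finite Y; Y \<noteq> {}\<rbrakk> \<Longrightarrow>
      \<exists>Z\<subseteq>Y. Z \<noteq> {} \<and> \<kappa> * card Y \<le> card Z \<and> concentrated W x \<delta> Z"
    using concentrated_subset_exists[OF \<delta>] by metis
  have "\<exists>\<C>. finite \<C> \<and> \<Union>\<C> \<subseteq> U \<and> pairwise disjnt \<C> \<and> card (U - \<Union>\<C>) \<le> \<delta> * m \<and>
      (\<forall>Y\<in>\<C>. Y \<noteq> {} \<and> \<kappa> * \<delta> * m \<le> card Y \<and> concentrated W x \<delta> Y)"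
    if "finite U" "\<forall>v\<in>U. unit_on W (x v)" "0 \<le> m" for U W and x :: "'v \<Rightarrow> 'w \<Rightarrow> real" and m :: real
    using that
  proof (induction U rule: finite_psubset_induct)
    case (psubset U)
    show ?case
    proof (cases "card U \<le> \<delta> * m")
      case True
      then show ?thesis by (intro exI[of _ "{}"]) (auto simp: pairwise_def)
    next
      case False
      then have "U \<noteq> {}" using psubset.prems \<delta> by auto
      then obtain Z where Z: "Z \<subseteq> U" "Z \<noteq> {}" "\<kappa> * card U \<le> card Z" "concentrated W x \<delta> Z"
        using sub[OF psubset.prems(1) psubset.hyps] by auto
      have "\<kappa> * (\<delta> * m) \<le> \<kappa> * card U" using False \<kappa> by (intro mult_left_mono) auto
      then have big: "\<kappa> * \<delta> * m \<le> card Z" using Z(3) by simp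
      have "U - Z \<subset> U" using Z by blast
      then obtain \<C> where C: "finite \<C>" "\<Union>\<C> \<subseteq> U - Z" "pairwise disjnt \<C>" "card (U - Z - \<Union>\<C>) \<le> \<delta> * m"
        "\<forall>Y\<in>\<C>. Y \<noteq> {} \<and> \<kappa> * \<delta> * m \<le> card Y \<and> concentrated W x \<delta> Y"
        using psubset.IH[of "U - Z"] psubset.prems by auto
      have "U - \<Union>(insert Z \<C>) = U - Z - \<Union>\<C>" by auto
      moreover have "pairwise disjnt (insert Z \<C>)"
        using C(2,3) by (auto simp: pairwise_insert disjnt_def)
      ultimately show ?thesis using C Z big by (intro exI[of _ "insert Z \<C>"]) auto
    qed
  qed
  note main = this
  show ?thesis
  proof (intro exI[of _ "\<kappa> * \<delta>"] conjI allI impI)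
    show "0 < \<kappa> * \<delta>" using \<kappa> \<delta> by simp
  qed (rule main, auto)
qed

lemma mean_compl:
  assumes "finite Y" "Y \<noteq> {}"
  shows "mean Y (\<lambda>v w. 1 - x v w) = (\<lambda>w. 1 - mean Y x w)"
  using assms by (auto simp: mean_def sum_subtractf diff_divide_distrib)

lemma concentrated_compl:
  assumes "finite Y" "Y \<noteq> {}" "concentrated W x \<delta> Y"
  shows "concentrated W (\<lambda>v w. 1 - x v w) \<delta> Y"
proof -
  have "ip W f (\<lambda>w. 1 - x v w) - ip W f (\<lambda>w. 1 - mean Y x w) = - (ip W f (x v) - ip W f (mean Y x))"
    for f v by (simp add: ip_diff_right)
  then have "\<bar>ip W f (\<lambda>w. 1 - x v w) - ip W f (\<lambda>w. 1 - mean Y x w)\<bar> =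
      \<bar>ip W f (x v) - ip W f (mean Y x)\<bar>" for f v by (metis abs_minus_cancel)
  then show ?thesis
    using assms(3) unfolding concentrated_def mean_compl[OF assms(1,2)] by simp
qed

text \<open>Replace first the right vector by its mean, testing \<open>Z\<close> against single vectors, and then the
  left one, testing \<open>Y\<close> against the mean of \<open>Z\<close>.  Hence codegrees are nearly constant between two
  concentrated sets.\<close>

lemma concentrated_pair:
  assumes x: "\<And>v. v \<in> Y \<union> Z \<Longrightarrow> unit_on W (x v)"
    and Y: "finite Y" "Y \<noteq> {}" "concentrated W x \<delta> Y" and Z: "finite Z" "Z \<noteq> {}" "concentrated W x \<delta> Z"
  shows "(\<Sum>(u, v)\<in>Y \<times> Z. \<bar>ip W (x u) (x v) - ip W (mean Y x) (mean Z x)\<bar>) \<le> 2 * \<delta> * card Y * card Z"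
proof -
  have unitZ: "unit_on W (mean Z x)" using x by (intro mean_unit) auto
  have 1: "(\<Sum>v\<in>Z. \<bar>ip W (x u) (x v) - ip W (x u) (mean Z x)\<bar>) \<le> \<delta> * card Z" if "u \<in> Y" for u
    using Z(3) x that unfolding concentrated_def by simp
  have 2: "(\<Sum>u\<in>Y. \<bar>ip W (x u) (mean Z x) - ip W (mean Y x) (mean Z x)\<bar>) \<le> \<delta> * card Y"
    using Y(3) unitZ unfolding concentrated_def by (simp add: ip_commute[of W _ "mean Z x"])
  have "(\<Sum>(u, v)\<in>Y \<times> Z. \<bar>ip W (x u) (x v) - ip W (mean Y x) (mean Z x)\<bar>)
      = (\<Sum>u\<in>Y. \<Sum>v\<in>Z. \<bar>ip W (x u) (x v) - ip W (mean Y x) (mean Z x)\<bar>)"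
    by (simp add: sum.cartesian_product)
  also have "\<dots> \<le> (\<Sum>u\<in>Y. \<Sum>v\<in>Z. \<bar>ip W (x u) (x v) - ip W (x u) (mean Z x)\<bar>
      + \<bar>ip W (x u) (mean Z x) - ip W (mean Y x) (mean Z x)\<bar>)"
    by (intro sum_mono) linarith
  also have "\<dots> = (\<Sum>u\<in>Y. \<Sum>v\<in>Z. \<bar>ip W (x u) (x v) - ip W (x u) (mean Z x)\<bar>)
      + card Z * (\<Sum>u\<in>Y. \<bar>ip W (x u) (mean Z x) - ip W (mean Y x) (mean Z x)\<bar>)"
    by (simp add: sum.distrib sum_distrib_left)
  also have "\<dots> \<le> (\<Sum>u\<in>Y. \<delta> * card Z) + card Z * (\<delta> * card Y)"
    using 1 2 by (intro add_mono sum_mono mult_left_mono) auto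
  also have "\<dots> = 2 * \<delta> * card Y * card Z" by simp
  finally show ?thesis .
qed

text \<open>Because the inner products hardly vary, a bound on a positive proportion of them passes to
  all of them.  This turns the codegree condition on red edges into a condition on cells.\<close>

lemma mean_ip_le_of_many_pairs:
  fixes \<eta> :: real
  assumes x: "\<And>v. v \<in> Y \<union> Z \<Longrightarrow> unit_on W (x v)"
    and Y: "finite Y" "Y \<noteq> {}" "concentrated W x \<delta> Y" and Z: "finite Z" "Z \<noteq> {}" "concentrated W x \<delta> Z"
    and T: "T \<subseteq> Y \<times> Z" "\<eta> * card Y * card Z \<le> card T" and "0 < \<eta>"
    and le: "\<And>u v. (u, v) \<in> T \<Longrightarrow> ip W (x u) (x v) \<le> a"
  shows "ip W (mean Y x) (mean Z x) \<le> a + 2 * \<delta> / \<eta>"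
proof (rule ccontr)
  assume "\<not> ?thesis"
  then have gt: "2 * \<delta> / \<eta> < ip W (mean Y x) (mean Z x) - a" by simp
  define M where "M = ip W (mean Y x) (mean Z x)"
  have finT: "finite T" using T Y Z by (meson finite_SigmaI finite_subset)
  have pos: "0 < real (card Y)" "0 < real (card Z)" using Y Z by (auto simp: card_gt_0_iff)
  have "0 < \<eta> * card Y * card Z" using pos \<open>0 < \<eta>\<close> by simp
  then have T0: "0 < real (card T)" using T by linarith
  have \<delta>: "0 \<le> \<delta>"
  proof -
    have "0 \<le> (\<Sum>(u, v)\<in>Y \<times> Z. \<bar>ip W (x u) (x v) - M\<bar>)" by (intro sum_nonneg) auto
    then have "0 \<le> 2 * \<delta> * card Y * card Z"
      using concentrated_pair[OF x Y Z] unfolding M_def by linarith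
    then show ?thesis using pos by (simp add: zero_le_mult_iff)
  qed
  have "card T * (M - a) = (\<Sum>(u, v)\<in>T. M - a)" by simp
  also have "\<dots> \<le> (\<Sum>(u, v)\<in>T. \<bar>ip W (x u) (x v) - M\<bar>)"
    using le by (intro sum_mono) fastforce
  also have "\<dots> \<le> (\<Sum>(u, v)\<in>Y \<times> Z. \<bar>ip W (x u) (x v) - M\<bar>)"
    using T Y Z by (intro sum_mono2) auto
  also have "\<dots> \<le> 2 * \<delta> * card Y * card Z"
    unfolding M_def by (rule concentrated_pair[OF x Y Z])
  also have "\<dots> = 2 * \<delta> / \<eta> * (\<eta> * card Y * card Z)" using \<open>0 < \<eta>\<close> by simp
  also have "\<dots> \<le> 2 * \<delta> / \<eta> * card T" using T(2) \<delta> \<open>0 < \<eta>\<close> by (intro mult_left_mono) auto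
  finally have "card T * (M - a) \<le> card T * (2 * \<delta> / \<eta>)" by (simp add: mult.commute)
  moreover have "card T * (2 * \<delta> / \<eta>) < card T * (M - a)"
    using gt T0 unfolding M_def by (rule mult_strict_left_mono)
  ultimately show False by linarith
qed

section \<open>The two-coloured cell structure\<close>

text \<open>Both sides agree at \<open>x = y = p\<close>, where the weights make the gradient of the right side vanish; its
  quadratic form is positive semidefinite exactly when \<open>p \<le> 1 / 2\<close>.\<close>

lemma quadratic_pair:
  fixes p x y :: real
  assumes "0 < p" "p \<le> 1 / 2"
  shows "2 * p\<^sup>2 * (1 - p) + 2 * p * (1 - p)\<^sup>2 \<le> (1 - p) * (x\<^sup>2 + y\<^sup>2) + 2 * p * ((1 - x) * (1 - y))"
proof -
  have "(1 - p) * (x\<^sup>2 + y\<^sup>2) + 2 * p * ((1 - x) * (1 - y)) - (2 * p\<^sup>2 * (1 - p) + 2 * p * (1 - p)\<^sup>2)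
      = p * (x + y - 2 * p)\<^sup>2 + (1 - 2 * p) * ((x - p)\<^sup>2 + (y - p)\<^sup>2)"
    by algebra
  moreover have "0 \<le> p * (x + y - 2 * p)\<^sup>2 + (1 - 2 * p) * ((x - p)\<^sup>2 + (y - p)\<^sup>2)"
    using assms by (intro add_nonneg_nonneg mult_nonneg_nonneg) auto
  ultimately show ?thesis by linarith
qed

text \<open>The analogue for three variables, with equality at \<open>x = y = z = p\<close>.  Here positive semidefiniteness
  is where \<open>1 / 3 \<le> p\<close>, that is \<open>1 / 4 \<le> \<alpha>\<close>, enters.\<close>

lemma quadratic_triple:
  fixes p x y z :: real
  assumes "1 / 3 \<le> p" "p \<le> 1"
  shows "3 * p * (1 - p)\<^sup>2 + 3 * (1 - p) * p\<^sup>2 \<le>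
    p * ((1 - x)\<^sup>2 + (1 - y)\<^sup>2 + (1 - z)\<^sup>2) + (1 - p) * (x * y + x * z + y * z)"
proof -
  have "2 * (p * ((1 - x)\<^sup>2 + (1 - y)\<^sup>2 + (1 - z)\<^sup>2) + (1 - p) * (x * y + x * z + y * z)
      - (3 * p * (1 - p)\<^sup>2 + 3 * (1 - p) * p\<^sup>2))
      = (1 - p) * (x + y + z - 3 * p)\<^sup>2 + (3 * p - 1) * ((x - p)\<^sup>2 + (y - p)\<^sup>2 + (z - p)\<^sup>2)"
    (is "2 * ?t = ?s")
    by algebra
  moreover have "0 \<le> ?s"
    using assms by (intro add_nonneg_nonneg mult_nonneg_nonneg) auto
  ultimately have "0 \<le> 2 * ?t" by (simp only:)
  then show ?thesis by (simp only: zero_le_mult_iff diff_ge_0_iff_ge) simp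
qed

lemma ip_pair_bound:
  assumes W: "finite W" "W \<noteq> {}" and p: "0 < p" "p \<le> 1 / 2"
  shows "2 * p\<^sup>2 * (1 - p) + 2 * p * (1 - p)\<^sup>2 \<le>
    (1 - p) * (ip W f f + ip W g g) + 2 * p * ip W (\<lambda>w. 1 - f w) (\<lambda>w. 1 - g w)" (is "?c \<le> ?r")
proof -
  have cW: "0 < real (card W)" using W by (simp add: card_gt_0_iff)
  have "card W * ?c = (\<Sum>w\<in>W. ?c)" by simp
  also have "\<dots> \<le> (\<Sum>w\<in>W. (1 - p) * ((f w)\<^sup>2 + (g w)\<^sup>2) + 2 * p * ((1 - f w) * (1 - g w)))"
    using p by (intro sum_mono quadratic_pair)
  also have "\<dots> = card W * ?r"
    unfolding sum.distrib sum_distrib_left[symmetric] ip_def power2_eq_square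
    using cW by (simp add: field_simps)
  finally show ?thesis using cW by (simp add: mult_le_cancel_left)
qed

lemma ip_triple_bound:
  assumes W: "finite W" "W \<noteq> {}" and p: "1 / 3 \<le> p" "p \<le> 1"
  shows "3 * p * (1 - p)\<^sup>2 + 3 * (1 - p) * p\<^sup>2 \<le>
    p * (ip W (\<lambda>w. 1 - f w) (\<lambda>w. 1 - f w) + ip W (\<lambda>w. 1 - g w) (\<lambda>w. 1 - g w)
      + ip W (\<lambda>w. 1 - h w) (\<lambda>w. 1 - h w)) + (1 - p) * (ip W f g + ip W f h + ip W g h)" (is "?c \<le> ?r")
proof -
  have cW: "0 < real (card W)" using W by (simp add: card_gt_0_iff)
  have "card W * ?c = (\<Sum>w\<in>W. ?c)" by simp
  also have "\<dots> \<le> (\<Sum>w\<in>W. p * ((1 - f w)\<^sup>2 + (1 - g w)\<^sup>2 + (1 - h w)\<^sup>2)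
      + (1 - p) * (f w * g w + f w * h w + g w * h w))"
    using p by (intro sum_mono quadratic_triple)
  also have "\<dots> = card W * ?r"
    unfolding sum.distrib sum_distrib_left[symmetric] ip_def power2_eq_square
    using cW by (simp add: field_simps)
  finally show ?thesis using cW by (simp add: mult_le_cancel_left)
qed

text \<open>A vector that is close to \<open>1\<close> on average over each of several disjoint sets is about as long as
  the indicator of their union, by the tangent line \<open>2 t - 1 \<le> t\<^sup>2\<close> at \<open>t = 1\<close>.\<close>

lemma ip_self_lower_bound:
  fixes f :: "'w \<Rightarrow> real" and t :: real
  assumes "finite W" "pairwise disjnt \<D>" "\<Union>\<D> \<subseteq> W"
    and avg: "\<And>Z. Z \<in> \<D> \<Longrightarrow> t * card Z \<le> (\<Sum>w\<in>Z. f w)"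
  shows "(2 * t - 1) * card (\<Union>\<D>) \<le> card W * ip W f f"
proof -
  have fin: "\<And>Z. Z \<in> \<D> \<Longrightarrow> finite Z" "finite (\<Union>\<D>)"
    using assms by (meson Sup_upper finite_subset order_trans)+
  have "(2 * t - 1) * card (\<Union>\<D>) = (\<Sum>Z\<in>\<D>. (2 * t - 1) * card Z)"
    using assms(2) fin by (simp add: card_Union_disjoint sum_distrib_left)
  also have "\<dots> \<le> (\<Sum>Z\<in>\<D>. \<Sum>w\<in>Z. 2 * f w - 1)"
  proof (rule sum_mono)
    fix Z assume "Z \<in> \<D>"
    have "(\<Sum>w\<in>Z. 2 * f w - 1) = 2 * (\<Sum>w\<in>Z. f w) - card Z"
      by (simp add: sum_subtractf sum_distrib_left)
    then show "(2 * t - 1) * card Z \<le> (\<Sum>w\<in>Z. 2 * f w - 1)"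
      using avg[OF \<open>Z \<in> \<D>\<close>] by (simp add: algebra_simps)
  qed
  also have "\<dots> = (\<Sum>w\<in>\<Union>\<D>. 2 * f w - 1)"
    using assms(2) fin by (subst sum.Union_disjoint) (auto simp: pairwise_def disjnt_def)
  also have "\<dots> \<le> (\<Sum>w\<in>\<Union>\<D>. f w * f w)"
  proof (rule sum_mono)
    fix w show "2 * f w - 1 \<le> f w * f w"
      using zero_le_power2[of "f w - 1"] by (simp add: power2_eq_square algebra_simps)
  qed
  also have "\<dots> \<le> (\<Sum>w\<in>W. f w * f w)"
    using assms by (intro sum_mono2) auto
  also have "\<dots> = card W * ip W f f"
    using assms(1) by (cases "W = {}") (auto simp: ip_def)
  finally show ?thesis .
qed

text \<open>The heart of the upper bound.  In its use, \<open>d Y\<close> is the average red neighbourhood of the cell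
  \<open>Y\<close>, and \<open>\<rho> Y Z\<close> the red density between two cells.  Call a cell blue if it has a fair share of blue
  inside, and red otherwise.

  Two red cells cannot have a fair share of blue between them (lemma \<open>quadratic_pair\<close>), so a red
  neighbourhood covers almost the whole red part, whose size is therefore at most about \<open>a\<close>.
  Among the blue cells, joining those with a fair share of red gives a graph without triangles
  (lemma \<open>quadratic_triple\<close>) and without loops.  The neighbourhoods of two adjacent cells are disjoint, so some blue
  cell is almost completely blue to half of the blue part.  Since its blue neighbourhood has
  squared length at most \<open>b\<close>, the blue part has size at most about \<open>2 b\<close>.\<close>

lemma cell_configuration:
  fixes d :: "'w set \<Rightarrow> 'w \<Rightarrow> real" and \<eta> :: real
  defines "\<rho> \<equiv> \<lambda>Y Z. (\<Sum>w\<in>Z. d Y w) / card Z"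
  assumes W: "finite W" "W \<noteq> {}"
    and C: "\<Union>\<C> \<subseteq> W" "pairwise disjnt \<C>" "{} \<notin> \<C>"
    and p: "1 / 3 \<le> p" "p \<le> 1 / 2" and \<eta>: "0 < \<eta>" "\<eta> \<le> 1 / 4"
    and ab: "a < p\<^sup>2" "b < (1 - p)\<^sup>2" "0 \<le> b"
    and red: "\<And>Y Z. \<lbrakk>Y \<in> \<C>; Z \<in> \<C>; 2 * \<eta> \<le> \<rho> Y Z\<rbrakk> \<Longrightarrow> ip W (d Y) (d Z) \<le> a"
    and blue: "\<And>Y Z. \<lbrakk>Y \<in> \<C>; Z \<in> \<C>; \<rho> Y Z \<le> 1 - 2 * \<eta>\<rbrakk> \<Longrightarrow>
      ip W (\<lambda>w. 1 - d Y w) (\<lambda>w. 1 - d Z w) \<le> b"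
    and "0 \<le> a"
  shows "(1 - 4 * \<eta>) * card (\<Union>\<C>) \<le> (a + 2 * b) * card W"
proof -
  define B where "B = {Y \<in> \<C>. \<rho> Y Y \<le> 1 - 2 * \<eta>}"
  define R where "R = \<C> - B"
  have finC: "finite \<C>" using C(1) W(1) by (meson finite_UnionD finite_subset)
  have fin: "finite Z" if "Z \<in> \<C>" for Z
    using that C(1) W(1) by (meson Sup_upper finite_subset order_trans)
  have card_pos: "0 < real (card Z)" if "Z \<in> \<C>" for Z
    using fin[OF that] C(3) that by (auto simp: card_gt_0_iff)
  have sum_d: "(\<Sum>w\<in>Z. d Y w) = \<rho> Y Z * card Z" if "Z \<in> \<C>" for Y Z
    using card_pos[OF that] by (simp add: \<rho>_def)
  have disj: "pairwise disjnt \<D>" if "\<D> \<subseteq> \<C>" for \<D>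
    using C(2) that by (rule pairwise_subset)
  have card_Un: "card (\<Union>\<D>) = (\<Sum>Z\<in>\<D>. card Z)" if "\<D> \<subseteq> \<C>" for \<D>
    using disj[OF that] fin that by (intro card_Union_disjoint) auto
  have R_part: "(1 - 4 * \<eta>) * card (\<Union>R) \<le> a * card W"
  proof (cases "R = {}")
    case True
    then show ?thesis using \<open>0 \<le> a\<close> by simp
  next
    case False
    have dense: "1 - 2 * \<eta> < \<rho> Y Z" if YZ: "Y \<in> R" "Z \<in> R" for Y Z
    proof (rule ccontr)
      assume "\<not> ?thesis"
      then have "ip W (\<lambda>w. 1 - d Y w) (\<lambda>w. 1 - d Z w) \<le> b"
        using blue YZ by (auto simp: R_def)
      moreover have "ip W (d Y) (d Y) \<le> a" "ip W (d Z) (d Z) \<le> a"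
        using red[of Y Y] red[of Z Z] YZ \<eta> by (auto simp: R_def B_def)
      ultimately have "(1 - p) * (ip W (d Y) (d Y) + ip W (d Z) (d Z))
          + 2 * p * ip W (\<lambda>w. 1 - d Y w) (\<lambda>w. 1 - d Z w) \<le> (1 - p) * (a + a) + 2 * p * b"
        using p by (intro add_mono mult_left_mono) auto
      moreover have "2 * p\<^sup>2 * (1 - p) + 2 * p * (1 - p)\<^sup>2 \<le> (1 - p) * (ip W (d Y) (d Y) + ip W (d Z) (d Z))
          + 2 * p * ip W (\<lambda>w. 1 - d Y w) (\<lambda>w. 1 - d Z w)"
        using p by (intro ip_pair_bound W) auto
      moreover have "(1 - p) * (a + a) < (1 - p) * (p\<^sup>2 + p\<^sup>2)" "2 * p * b < 2 * p * (1 - p)\<^sup>2"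
        using p ab by (intro mult_strict_left_mono; auto)+
      ultimately show False by (simp add: algebra_simps)
    qed
    obtain Y where Y: "Y \<in> R" using False by blast
    have "(2 * (1 - 2 * \<eta>) - 1) * card (\<Union>R) \<le> card W * ip W (d Y) (d Y)"
    proof (rule ip_self_lower_bound[OF W(1)])
      show "(1 - 2 * \<eta>) * card Z \<le> (\<Sum>w\<in>Z. d Y w)" if "Z \<in> R" for Z
        using dense[OF Y that] that unfolding R_def by (simp add: sum_d mult_right_mono)
    qed (use C disj[of R] in \<open>auto simp: R_def\<close>)
    also have "\<dots> \<le> card W * a"
      using red[of Y Y] dense[OF Y Y] Y \<eta> by (intro mult_left_mono) (auto simp: R_def)
    finally show ?thesis by (simp add: algebra_simps)
  qed
  define nb where "nb Y = {Z \<in> B. 2 * \<eta> \<le> \<rho> Y Z}" for Y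
  \<comment> \<open>The cells need not be distinct; with \<open>X = Y = Z\<close> this rules out
    loops.\<close>
  have no_triangle: False
    if "X \<in> B" "Y \<in> B" "Z \<in> B" "2 * \<eta> \<le> \<rho> X Y" "2 * \<eta> \<le> \<rho> X Z" "2 * \<eta> \<le> \<rho> Y Z" for X Y Z
  proof -
    have e: "ip W (\<lambda>w. 1 - d V w) (\<lambda>w. 1 - d V w) \<le> b" if "V \<in> B" for V
      using blue[of V V] that by (auto simp: B_def)
    have "p * (ip W (\<lambda>w. 1 - d X w) (\<lambda>w. 1 - d X w) + ip W (\<lambda>w. 1 - d Y w) (\<lambda>w. 1 - d Y w)
      + ip W (\<lambda>w. 1 - d Z w) (\<lambda>w. 1 - d Z w)) + (1 - p) * (ip W (d X) (d Y) + ip W (d X) (d Z) + ip W (d Y) (d Z))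
      \<le> p * (b + b + b) + (1 - p) * (a + a + a)"
      using p that e red by (intro add_mono mult_left_mono) (auto simp: B_def)
    moreover have "3 * p * (1 - p)\<^sup>2 + 3 * (1 - p) * p\<^sup>2 \<le> p * (ip W (\<lambda>w. 1 - d X w) (\<lambda>w. 1 - d X w)
      + ip W (\<lambda>w. 1 - d Y w) (\<lambda>w. 1 - d Y w) + ip W (\<lambda>w. 1 - d Z w) (\<lambda>w. 1 - d Z w))
      + (1 - p) * (ip W (d X) (d Y) + ip W (d X) (d Z) + ip W (d Y) (d Z))"
      using p by (intro ip_triple_bound W) auto
    moreover have "3 * p * b < 3 * p * (1 - p)\<^sup>2" "3 * (1 - p) * a < 3 * (1 - p) * p\<^sup>2"
      using p ab by (intro mult_strict_left_mono; auto)+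
    ultimately show False by (simp add: algebra_simps)
  qed
  have B_part: "(1 - 4 * \<eta>) * card (\<Union>B) \<le> 2 * b * card W"
  proof (cases "B = {}")
    case True
    then show ?thesis using ab by simp
  next
    case False
    have "\<exists>Y\<in>B. 2 * card (\<Union>(nb Y)) \<le> card (\<Union>B)"
    proof (cases "\<exists>X\<in>B. nb X \<noteq> {}")
      case True
      then obtain X Y where XY: "X \<in> B" "Y \<in> B" "2 * \<eta> \<le> \<rho> X Y" by (auto simp: nb_def)
      then have "nb X \<inter> nb Y = {}" using no_triangle[of X Y] by (auto simp: nb_def)
      moreover have sub: "nb X \<subseteq> B" "nb Y \<subseteq> B" "B \<subseteq> \<C>" "finite B" using finC by (auto simp: nb_def B_def)
      ultimately have "(\<Sum>Z\<in>nb X. card Z) + (\<Sum>Z\<in>nb Y. card Z) = (\<Sum>Z\<in>nb X \<union> nb Y. card Z)"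
        by (intro sum.union_disjoint[symmetric]) (auto intro: finite_subset)
      also have "\<dots> \<le> (\<Sum>Z\<in>B. card Z)" using sub by (intro sum_mono2) auto
      finally have "card (\<Union>(nb X)) + card (\<Union>(nb Y)) \<le> card (\<Union>B)"
        using card_Un[of "nb X"] card_Un[of "nb Y"] card_Un[of B] sub by auto
      then have "2 * card (\<Union>(nb X)) \<le> card (\<Union>B) \<or> 2 * card (\<Union>(nb Y)) \<le> card (\<Union>B)" by linarith
      then show ?thesis using XY by blast
    next
      case False
      then show ?thesis using \<open>B \<noteq> {}\<close> by auto
    qed
    then obtain Y where Y: "Y \<in> B" "2 * card (\<Union>(nb Y)) \<le> card (\<Union>B)" by blast
    have sub: "nb Y \<subseteq> \<C>" "B - nb Y \<subseteq> \<C>" "B \<subseteq> \<C>" "nb Y \<subseteq> B" by (auto simp: nb_def B_def)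
    have "card (\<Union>B) = card (\<Union>(nb Y)) + card (\<Union>(B - nb Y))"
      unfolding card_Un[OF sub(1)] card_Un[OF sub(2)] card_Un[OF sub(3)]
      using sum.subset_diff[OF sub(4), of card] finC sub(3) by (simp add: finite_subset add.commute)
    then have half: "real (card (\<Union>B)) \<le> 2 * real (card (\<Union>(B - nb Y)))" using Y(2) by linarith
    have "(2 * (1 - 2 * \<eta>) - 1) * card (\<Union>(B - nb Y)) \<le> card W * ip W (\<lambda>w. 1 - d Y w) (\<lambda>w. 1 - d Y w)"
    proof (rule ip_self_lower_bound[OF W(1)])
      fix Z assume Z: "Z \<in> B - nb Y"
      then have "\<rho> Y Z * card Z \<le> 2 * \<eta> * card Z" by (intro mult_right_mono) (auto simp: nb_def)
      then show "(1 - 2 * \<eta>) * card Z \<le> (\<Sum>w\<in>Z. 1 - d Y w)"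
        using sum_d[of Z Y] Z sub by (simp add: sum_subtractf algebra_simps subset_iff)
    qed (use C disj[OF sub(2)] sub(2) in auto)
    also have "\<dots> \<le> card W * b"
      using blue[of Y Y] Y by (intro mult_left_mono) (auto simp: B_def)
    finally have "(1 - 4 * \<eta>) * card (\<Union>(B - nb Y)) \<le> b * card W" by (simp add: algebra_simps)
    moreover have "(1 - 4 * \<eta>) * card (\<Union>B) \<le> (1 - 4 * \<eta>) * (2 * card (\<Union>(B - nb Y)))"
      using half \<eta> by (intro mult_left_mono) auto
    ultimately show ?thesis by (simp add: mult.assoc mult.left_commute)
  qed
  have RB: "R \<subseteq> \<C>" "B \<subseteq> \<C>" "R = \<C> - B" by (auto simp: R_def B_def)
  have "card (\<Union>\<C>) = card (\<Union>R) + card (\<Union>B)"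
    using sum.subset_diff[OF RB(2) finC, of card] card_Un[OF RB(1)] card_Un[OF RB(2)]
      card_Un[OF order_refl] RB(3) by simp
  then show ?thesis using R_part B_part by (simp add: algebra_simps)
qed

section \<open>Large monochromatic codegrees\<close>

text \<open>The indicator vectors also record the values of the colouring on the singletons \<open>{u}\<close> and \<open>{v}\<close>,
  which makes the red and the blue vector of a vertex complementary.  The codegree is changed by
  at most \<open>2\<close>.\<close>

lemma ip_colour_le:
  "ip {..<N} (\<lambda>w. of_bool (c {u, w} = k)) (\<lambda>w. of_bool (c {v, w} = k))
    \<le> (card (common_nbrs N c k u v) + 2) / N"
proof -
  have "(\<Sum>w<N. of_bool (c {u, w} = k) * of_bool (c {v, w} = k) :: real)
      = (\<Sum>w<N. of_bool (c {u, w} = k \<and> c {v, w} = k))"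
    by (intro sum.cong) auto
  also have "\<dots> = card ({..<N} \<inter> {w. c {u, w} = k \<and> c {v, w} = k})"
    by (subst sum_of_bool_eq) auto
  also have "\<dots> \<le> card (common_nbrs N c k u v \<union> {u, v})"
    by (intro of_nat_mono card_mono) (auto simp: common_nbrs_def)
  also have "\<dots> \<le> card (common_nbrs N c k u v) + 2"
    using card_Un_le[of "common_nbrs N c k u v" "{u, v}"] card_insert_le_m1[of 2 "{v}" u]
    by (simp flip: of_nat_add)
  finally show ?thesis
    unfolding ip_def by (simp add: divide_right_mono)
qed

text \<open>The diagonal pairs make up at most an \<open>\<eta>\<close>-fraction of \<open>Y \<times> Z\<close>; they have to be discarded because
  the codegree condition concerns edges only.\<close>

lemma many_distinct_pairs:
  fixes P :: "'a \<Rightarrow> 'a \<Rightarrow> bool" and \<eta> :: real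
  assumes Y: "finite Y" "Y \<noteq> {}" and Z: "finite Z" "Z \<noteq> {}" and \<eta>: "1 \<le> \<eta> * card Z"
    and dens: "2 * \<eta> \<le> (\<Sum>w\<in>Z. mean Y (\<lambda>v w. of_bool (P v w)) w) / card Z"
  shows "\<eta> * card Y * card Z \<le> card {(u, v) \<in> Y \<times> Z. u \<noteq> v \<and> P u v}"
proof -
  have pos: "0 < real (card Y)" "0 < real (card Z)" using Y Z by (auto simp: card_gt_0_iff)
  have "(\<Sum>w\<in>Z. \<Sum>v\<in>Y. of_bool (P v w) :: real) = (\<Sum>(v, w)\<in>Y \<times> Z. of_bool (P v w))"
    by (subst sum.swap) (simp add: sum.cartesian_product)
  also have "\<dots> = card ((Y \<times> Z) \<inter> {(v, w). P v w})"
    using Y Z by (simp add: case_prod_unfold sum_of_bool_eq)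
  finally have count: "(\<Sum>w\<in>Z. mean Y (\<lambda>v w. of_bool (P v w)) w) =
      card ((Y \<times> Z) \<inter> {(v, w). P v w}) / card Y"
    by (simp add: mean_def sum_divide_distrib[symmetric])
  have "card ((Y \<times> Z) \<inter> {(v, w). P v w}) \<le> card ({(u, v) \<in> Y \<times> Z. u \<noteq> v \<and> P u v} \<union> (\<lambda>v. (v, v)) ` Y)"
    using Y Z by (intro card_mono finite_UnI finite_subset[of "{(u, v) \<in> Y \<times> Z. u \<noteq> v \<and> P u v}" "Y \<times> Z"]) auto
  also have "\<dots> \<le> card {(u, v) \<in> Y \<times> Z. u \<noteq> v \<and> P u v} + card Y"
    using card_Un_le card_image_le[OF Y(1), of "\<lambda>v. (v, v)"] by (meson add_left_mono order_trans)
  finally have le: "real (card ((Y \<times> Z) \<inter> {(v, w). P v w})) \<le> card {(u, v) \<in> Y \<times> Z. u \<noteq> v \<and> P u v} + card Y"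
    by (simp flip: of_nat_add)
  have "2 * \<eta> * (card Y * card Z) \<le> card ((Y \<times> Z) \<inter> {(v, w). P v w})"
    using dens pos unfolding count by (simp add: field_simps)
  moreover have "real (card Y) * 1 \<le> card Y * (\<eta> * card Z)"
    using \<eta> by (intro mult_left_mono) auto
  ultimately show ?thesis using le by (simp add: mult.assoc mult.left_commute)
qed

text \<open>Suppose all red codegrees are below \<open>p\<^sup>2 N\<close> and all blue ones below \<open>(1 - p)\<^sup>2 N\<close>, by a margin.  Then
  the average neighbourhoods of concentrated cells satisfy the hypotheses of
  \<open>cell_configuration\<close> with \<open>a\<close> and \<open>b\<close> slightly below \<open>p\<^sup>2\<close> and \<open>(1 - p)\<^sup>2\<close>.  As
  \<open>p\<^sup>2 + 2 (1 - p)\<^sup>2 \<le> 1\<close> amounts to \<open>(3 p - 1) (1 - p) \<ge> 0\<close>, the cells would then miss a fixed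
  proportion of the vertices, whereas they cover almost all of them.\<close>

lemma large_monochromatic_codegree:
  fixes p \<gamma> :: real
  assumes p: "1 / 3 \<le> p" "p \<le> 1 / 2" and \<gamma>: "0 < \<gamma>" "\<gamma> \<le> 1 / 10"
  shows "eventually (\<lambda>N. \<forall>c. \<exists>u<N. \<exists>v<N. u \<noteq> v \<and>
    (c {u, v} = Red \<and> (p\<^sup>2 - \<gamma>) * N \<le> card (common_nbrs N c Red u v) + 2 \<or>
     c {u, v} = Blue \<and> ((1 - p)\<^sup>2 - \<gamma>) * N \<le> card (common_nbrs N c Blue u v) + 2)) sequentially"
proof -
  define \<eta> where "\<eta> = \<gamma> / 8"
  \<comment> \<open>With these choices the concentration error \<open>2 \<delta> / \<eta>\<close> uses up half
    of the margin \<open>\<gamma>\<close>.\<close>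
  define \<delta> where "\<delta> = \<gamma>\<^sup>2 / 32"
  have \<gamma>2: "0 < \<gamma>\<^sup>2" "\<gamma>\<^sup>2 \<le> \<gamma>"
    using \<gamma> by (auto simp: power2_eq_square intro: mult_left_le)
  have \<eta>: "0 < \<eta>" "\<eta> \<le> 1 / 4" and \<delta>: "0 < \<delta>" "\<delta> \<le> 1" and \<delta>\<eta>: "2 * \<delta> / \<eta> = \<gamma> / 2"
    using \<gamma> \<gamma>2 by (auto simp: \<eta>_def \<delta>_def power2_eq_square)
  obtain \<kappa> :: real where \<kappa>: "0 < \<kappa>" and cells: "\<forall>W (x :: nat \<Rightarrow> nat \<Rightarrow> real) V.
      finite V \<longrightarrow> (\<forall>v\<in>V. unit_on W (x v)) \<longrightarrow>
      (\<exists>\<C>. finite \<C> \<and> \<Union>\<C> \<subseteq> V \<and> pairwise disjnt \<C> \<and> card (V - \<Union>\<C>) \<le> \<delta> * card V \<and>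
        (\<forall>Y\<in>\<C>. Y \<noteq> {} \<and> \<kappa> * card V \<le> card Y \<and> concentrated W x \<delta> Y))"
    using concentrated_cells[OF \<delta>, where 'v = nat and 'w = nat] by (elim exE conjE) (rule that)
  define a where "a = p\<^sup>2 - \<gamma> / 2"
  define b where "b = (1 - p)\<^sup>2 - \<gamma> / 2"
  have p2: "(1 / 3)\<^sup>2 \<le> p\<^sup>2" "(1 / 2)\<^sup>2 \<le> (1 - p)\<^sup>2" using p by (intro power_mono; simp)+
  have ab: "a < p\<^sup>2" "0 \<le> a" "b < (1 - p)\<^sup>2" "0 \<le> b"
    using p2 \<gamma> unfolding a_def b_def by (auto simp: power2_eq_square)
  have "0 \<le> (3 * p - 1) * (1 - p)" using p by simp
  then have ab_sum: "a + 2 * b \<le> 1 - 3 / 2 * \<gamma>"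
    unfolding a_def b_def by (simp add: power2_eq_square algebra_simps)
  have "\<exists>u<N. \<exists>v<N. u \<noteq> v \<and>
    (c {u, v} = Red \<and> (p\<^sup>2 - \<gamma>) * N \<le> card (common_nbrs N c Red u v) + 2 \<or>
     c {u, v} = Blue \<and> ((1 - p)\<^sup>2 - \<gamma>) * N \<le> card (common_nbrs N c Blue u v) + 2)"
    if N: "1 / (\<eta> * \<kappa>) \<le> real N" for N :: nat and c :: "nat set \<Rightarrow> colour"
  proof (rule ccontr)
    assume contra: "\<not> ?thesis"
    define W where "W = {..<N}"
    have finite_W: "finite W" by (simp add: W_def)
    define x where "x k v w = (of_bool (c {v, w} = k) :: real)" for k v w
    define q where "q k = (case k of Red \<Rightarrow> p\<^sup>2 | Blue \<Rightarrow> (1 - p)\<^sup>2)" for k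
    have "0 < 1 / (\<eta> * \<kappa>)" using \<eta> \<kappa> by simp
    then have N0: "0 < real N" using N by linarith
    have unit: "unit_on W (x k v)" for k v by (auto simp: x_def)
    have ip_le: "ip W (x k u) (x k v) \<le> q k - \<gamma>"
      if "u < N" "v < N" "u \<noteq> v" "c {u, v} = k" for k u v
    proof -
      have "card (common_nbrs N c k u v) + 2 \<le> (q k - \<gamma>) * N"
        using contra that by (cases k) (fastforce simp: q_def not_le)+
      then have "(card (common_nbrs N c k u v) + 2) / N \<le> q k - \<gamma>"
        using N0 by (simp add: field_simps)
      then show ?thesis
        using ip_colour_le[of N c u k v] unfolding W_def x_def by linarith
    qed
    have x_blue: "x Blue = (\<lambda>v w. 1 - x Red v w)"
    proof (intro ext)
      fix v w show "x Blue v w = 1 - x Red v w" by (cases "c {v, w}") (simp_all add: x_def)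
    qed
    have "\<exists>\<C>. finite \<C> \<and> \<Union>\<C> \<subseteq> W \<and> pairwise disjnt \<C> \<and> card (W - \<Union>\<C>) \<le> \<delta> * card W \<and>
        (\<forall>Y\<in>\<C>. Y \<noteq> {} \<and> \<kappa> * card W \<le> card Y \<and> concentrated W (x Red) \<delta> Y)"
      by (rule mp[OF mp[OF spec[OF spec[OF spec[OF cells]]] finite_W] ballI[OF unit]])
    then obtain \<C> where C: "\<Union>\<C> \<subseteq> W" "pairwise disjnt \<C>" "card (W - \<Union>\<C>) \<le> \<delta> * card W"
      and cells_C: "\<forall>Y\<in>\<C>. Y \<noteq> {} \<and> \<kappa> * card W \<le> card Y \<and> concentrated W (x Red) \<delta> Y"
      by (elim exE conjE)
    note cell = bspec[OF cells_C]
    have fin: "finite Y" if "Y \<in> \<C>" for Y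
      using that C(1) unfolding W_def by (meson Sup_upper finite_lessThan finite_subset order_trans)
    have conc: "concentrated W (x k) \<delta> Y" if "Y \<in> \<C>" for Y k
      using cell[OF that] concentrated_compl[OF fin[OF that], of W "x Red" \<delta>] x_blue by (cases k) auto
    have big: "1 \<le> \<eta> * card Y" if "Y \<in> \<C>" for Y
    proof -
      have "1 \<le> \<eta> * (\<kappa> * N)" using N \<eta> \<kappa> by (simp add: field_simps)
      also have "\<dots> \<le> \<eta> * card Y" using cell[OF that] \<eta> by (intro mult_left_mono) (auto simp: W_def)
      finally show ?thesis .
    qed
    have mean_ip: "ip W (mean Y (x k)) (mean Z (x k)) \<le> q k - \<gamma> / 2"
      if YZ: "Y \<in> \<C>" "Z \<in> \<C>" and dens: "2 * \<eta> \<le> (\<Sum>w\<in>Z. mean Y (x k) w) / card Z" for Y Z k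
    proof -
      define T where "T = {(u, v) \<in> Y \<times> Z. u \<noteq> v \<and> c {u, v} = k}"
      have "\<eta> * card Y * card Z \<le> card T"
        unfolding T_def using many_distinct_pairs[OF fin[OF YZ(1)] _ fin[OF YZ(2)] _ big[OF YZ(2)],
          where P = "\<lambda>u v. c {u, v} = k"] cell YZ dens unfolding x_def by auto
      moreover have "ip W (x k u) (x k v) \<le> q k - \<gamma>" if "(u, v) \<in> T" for u v
      proof (rule ip_le)
        show "u < N" "v < N" using that YZ C(1) by (auto simp: T_def W_def)
      qed (use that in \<open>auto simp: T_def\<close>)
      ultimately have "ip W (mean Y (x k)) (mean Z (x k)) \<le> q k - \<gamma> + 2 * \<delta> / \<eta>"
        using cell YZ fin conc \<eta> by (intro mean_ip_le_of_many_pairs[OF unit, where T = T]) (auto simp: T_def)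
      then show ?thesis unfolding \<delta>\<eta> by simp
    qed
    have "(1 - 4 * \<eta>) * card (\<Union>\<C>) \<le> (a + 2 * b) * card W"
    proof (rule cell_configuration[where d = "\<lambda>Y. mean Y (x Red)" and p = p])
      show "finite W" "W \<noteq> {}" using N0 by (auto simp: W_def)
      show "{} \<notin> \<C>" using cell by blast
      fix Y Z assume YZ: "Y \<in> \<C>" "Z \<in> \<C>"
      show "ip W (mean Y (x Red)) (mean Z (x Red)) \<le> a"
        if "2 * \<eta> \<le> (\<Sum>w\<in>Z. mean Y (x Red) w) / card Z"
        using mean_ip[OF YZ that] by (simp add: q_def a_def)
      have blue: "mean V (x Blue) = (\<lambda>w. 1 - mean V (x Red) w)" if "V \<in> \<C>" for V
        unfolding x_blue using cell that fin by (intro mean_compl) auto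
      have cZ: "0 < real (card Z)" using cell[OF YZ(2)] fin[OF YZ(2)] by (auto simp: card_gt_0_iff)
      show "ip W (\<lambda>w. 1 - mean Y (x Red) w) (\<lambda>w. 1 - mean Z (x Red) w) \<le> b"
        if "(\<Sum>w\<in>Z. mean Y (x Red) w) / card Z \<le> 1 - 2 * \<eta>"
      proof -
        have "2 * \<eta> \<le> (\<Sum>w\<in>Z. mean Y (x Blue) w) / card Z"
          using that cZ by (simp add: blue[OF YZ(1)] sum_subtractf diff_divide_distrib)
        from mean_ip[OF YZ this] show ?thesis by (simp add: blue YZ q_def b_def)
      qed
    qed (use C p \<eta> ab in auto)
    moreover have "(1 - 4 * \<eta>) * ((1 - \<delta>) * N) \<le> (1 - 4 * \<eta>) * card (\<Union>\<C>)"
    proof (rule mult_left_mono)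
      have "card (W - \<Union>\<C>) = card W - card (\<Union>\<C>)" "card (\<Union>\<C>) \<le> card W"
        using C(1) finite_W by (simp_all add: card_Diff_subset finite_subset card_mono)
      then show "(1 - \<delta>) * N \<le> card (\<Union>\<C>)"
        using C(3) by (simp add: W_def of_nat_diff algebra_simps)
    qed (use \<eta> in auto)
    ultimately have "(1 - 4 * \<eta>) * (1 - \<delta>) * N \<le> (a + 2 * b) * N" by (simp add: W_def mult.assoc)
    then have "(1 - 4 * \<eta>) * (1 - \<delta>) \<le> a + 2 * b" using N0 by (simp add: mult_le_cancel_right)
    moreover have "1 - 3 / 2 * \<gamma> < (1 - 4 * \<eta>) * (1 - \<delta>)"
    proof -
      have "0 \<le> 4 * \<eta> * \<delta>" using \<eta> \<delta> by simp
      then have "1 - 4 * \<eta> - \<delta> \<le> (1 - 4 * \<eta>) * (1 - \<delta>)" by (simp add: algebra_simps)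
      moreover have "1 - 3 / 2 * \<gamma> < 1 - 4 * \<eta> - \<delta>" unfolding \<eta>_def \<delta>_def using \<gamma>(1) \<gamma>2(2) by linarith
      ultimately show ?thesis by linarith
    qed
    ultimately show False using ab_sum by linarith
  qed
  moreover have "eventually (\<lambda>N. 1 / (\<eta> * \<kappa>) \<le> real N) sequentially"
    using filterlim_real_sequentially unfolding filterlim_at_top by blast
  ultimately show ?thesis by (auto elim!: eventually_mono)
qed

section \<open>Asymptotics of the Ramsey number\<close>

lemma filterlim_nat_floor_mult:
  assumes "0 < (r :: real)"
  shows "filterlim (\<lambda>n :: nat. nat \<lfloor>r * real n\<rfloor>) at_top sequentially"
proof -
  have "filterlim (\<lambda>n. r * real n) at_top sequentially"
    by (rule filterlim_tendsto_pos_mult_at_top[OF tendsto_const assms filterlim_real_sequentially])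
  then have "filterlim (\<lambda>n. \<lfloor>r * real n\<rfloor>) at_top sequentially"
    by (rule filterlim_compose[OF filterlim_floor_sequentially])
  then show ?thesis by (rule filterlim_compose[OF filterlim_nat_sequentially])
qed

lemma ramsey_number_book_upper:
  fixes p q K \<alpha> \<epsilon> :: real
  assumes p: "1 / 3 \<le> p" "p \<le> 1 / 2" and K: "0 < K" "p\<^sup>2 * K = \<alpha>" "(1 - p)\<^sup>2 * K = 1" and \<epsilon>: "0 < \<epsilon>"
  shows "eventually (\<lambda>n. ramsey_number (book (nat \<lceil>\<alpha> * real n\<rceil>)) (book n) \<le> (K + \<epsilon>) * n) sequentially"
proof -
  \<comment> \<open>As \<open>p\<^sup>2\<close> and \<open>(1 - p)\<^sup>2\<close> are at least
    \<open>1/9\<close>, the extra \<open>\<epsilon> n\<close> vertices raise the codegree threshold by at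
    least \<open>\<epsilon> n / 9\<close>; half of this absorbs the loss from \<open>\<gamma>\<close>, the
    other half the rounding.\<close>
  define \<gamma> where "\<gamma> = min (1 / 10) (\<epsilon> / (18 * (K + \<epsilon>)))"
  have \<gamma>: "0 < \<gamma>" "\<gamma> \<le> 1 / 10" "\<gamma> * (K + \<epsilon>) \<le> \<epsilon> / 18"
    using K \<epsilon> by (auto simp: \<gamma>_def field_simps min_def)
  have p2: "(1 / 3)\<^sup>2 \<le> p\<^sup>2" "(1 / 2)\<^sup>2 \<le> (1 - p)\<^sup>2" using p by (intro power_mono; simp)+
  have p2': "p\<^sup>2 \<le> 1" "(1 - p)\<^sup>2 \<le> 1" using p by (auto intro: power_le_one)
  define N where "N n = nat \<lfloor>(K + \<epsilon>) * real n\<rfloor>" for n :: nat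
  have limN: "filterlim N at_top sequentially"
    unfolding N_def using K \<epsilon> by (intro filterlim_nat_floor_mult) simp
  have "ramsey_number (book (nat \<lceil>\<alpha> * real n\<rceil>)) (book n) \<le> (K + \<epsilon>) * n"
    if good: "\<forall>c. \<exists>u<N n. \<exists>v<N n. u \<noteq> v \<and>
      (c {u, v} = Red \<and> (p\<^sup>2 - \<gamma>) * N n \<le> card (common_nbrs (N n) c Red u v) + 2 \<or>
       c {u, v} = Blue \<and> ((1 - p)\<^sup>2 - \<gamma>) * N n \<le> card (common_nbrs (N n) c Blue u v) + 2)"
      and n: "72 / \<epsilon> \<le> real n" for n :: nat
  proof -
    have Nn: "N n \<le> (K + \<epsilon>) * n" "(K + \<epsilon>) * n - 1 \<le> N n"
      using K \<epsilon> by (auto simp: N_def)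
    have "4 \<le> \<epsilon> / 18 * n" using n \<epsilon> by (simp add: field_simps)
    have enough: "r * K * n + 1 \<le> k"
      if r: "1 / 9 \<le> r" "r \<le> 1" and k: "(r - \<gamma>) * N n \<le> k + 2" for r k :: real
    proof -
      have "\<epsilon> * (1 / 9) \<le> \<epsilon> * r" using r \<epsilon> by (intro mult_left_mono) auto
      then have "r * K + \<epsilon> / 18 \<le> (r - \<gamma>) * (K + \<epsilon>)" using \<gamma> by (simp add: algebra_simps)
      then have "(r * K + \<epsilon> / 18) * n \<le> (r - \<gamma>) * (K + \<epsilon>) * n" by (rule mult_right_mono) simp
      moreover have "(r - \<gamma>) * ((K + \<epsilon>) * n - 1) \<le> (r - \<gamma>) * N n"
        using r \<gamma> Nn by (intro mult_left_mono) auto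
      ultimately show ?thesis using \<open>4 \<le> \<epsilon> / 18 * n\<close> k r \<gamma> by (simp add: algebra_simps)
    qed
    have "ramsey_property (book (nat \<lceil>\<alpha> * real n\<rceil>)) (book n) (N n)"
      unfolding ramsey_property_book_iff
    proof
      fix c
      obtain u v where uv: "u < N n" "v < N n" "u \<noteq> v"
        and colours: "c {u, v} = Red \<and> (p\<^sup>2 - \<gamma>) * N n \<le> card (common_nbrs (N n) c Red u v) + 2 \<or>
          c {u, v} = Blue \<and> ((1 - p)\<^sup>2 - \<gamma>) * N n \<le> card (common_nbrs (N n) c Blue u v) + 2"
        using good by blast
      from colours have "c {u, v} = Red \<and> nat \<lceil>\<alpha> * real n\<rceil> \<le> card (common_nbrs (N n) c Red u v) \<or>
          c {u, v} = Blue \<and> n \<le> card (common_nbrs (N n) c Blue u v)"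
      proof (elim disjE conjE)
        assume c: "c {u, v} = Red" and le: "(p\<^sup>2 - \<gamma>) * N n \<le> card (common_nbrs (N n) c Red u v) + 2"
        have "\<alpha> * n + 1 \<le> card (common_nbrs (N n) c Red u v)"
          using enough[of "p\<^sup>2"] le p2 p2' K by (simp add: power_divide)
        then have "nat \<lceil>\<alpha> * real n\<rceil> \<le> card (common_nbrs (N n) c Red u v)" by linarith
        with c show ?thesis by blast
      next
        assume c: "c {u, v} = Blue" and le: "((1 - p)\<^sup>2 - \<gamma>) * N n \<le> card (common_nbrs (N n) c Blue u v) + 2"
        have "1 * n + 1 \<le> card (common_nbrs (N n) c Blue u v)"
          using enough[of "(1 - p)\<^sup>2" "card (common_nbrs (N n) c Blue u v)"] le p2 p2' unfolding K(3)
          by (simp add: power_divide)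
        with c show ?thesis by simp
      qed
      then show "\<exists>u<N n. \<exists>v<N n. u \<noteq> v \<and>
          (c {u, v} = Red \<and> nat \<lceil>\<alpha> * real n\<rceil> \<le> card (common_nbrs (N n) c Red u v) \<or>
           c {u, v} = Blue \<and> n \<le> card (common_nbrs (N n) c Blue u v))"
        using uv by blast
    qed
    moreover have "0 < N n" using good by (metis gr_zeroI not_less_zero)
    ultimately have "ramsey_number (book (nat \<lceil>\<alpha> * real n\<rceil>)) (book n) \<le> N n"
      unfolding ramsey_number_def by (intro Least_le) simp
    then show ?thesis using Nn by linarith
  qed
  note main = this
  have "eventually (\<lambda>n. 72 / \<epsilon> \<le> real n) sequentially"
    using filterlim_real_sequentially unfolding filterlim_at_top by blast
  with eventually_compose_filterlim[OF large_monochromatic_codegree[OF p \<gamma>(1,2)] limN]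
  show ?thesis by eventually_elim (rule main)
qed

lemma ramsey_number_book_lower:
  fixes p K \<alpha> \<epsilon> :: real
  assumes p: "1 / 3 \<le> p" "p \<le> 1 / 2" and K: "0 < K" "p\<^sup>2 * K = \<alpha>" "(1 - p)\<^sup>2 * K = 1" and \<epsilon>: "0 < \<epsilon>"
  shows "eventually (\<lambda>n. (K - \<epsilon>) * n \<le> ramsey_number (book (nat \<lceil>\<alpha> * real n\<rceil>)) (book n)) sequentially"
proof (cases "\<epsilon> < K")
  case False
  then have "(K - \<epsilon>) * real n \<le> 0" for n by (simp add: mult_nonpos_nonneg)
  then show ?thesis by (intro always_eventually allI) (meson of_nat_0_le_iff order_trans)
next
  case True
  \<comment> \<open>The missing \<open>\<epsilon> n\<close> vertices lower the expected codegrees by at least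
    \<open>\<epsilon> n / 9\<close>, twice the error that \<open>\<gamma>\<close> allows.\<close>
  define \<gamma> where "\<gamma> = \<epsilon> / (18 * K)"
  have \<gamma>: "0 < \<gamma>" "\<gamma> * K = \<epsilon> / 18" using K \<epsilon> by (auto simp: \<gamma>_def)
  have p2: "(1 / 3)\<^sup>2 \<le> p\<^sup>2" "(1 / 2)\<^sup>2 \<le> (1 - p)\<^sup>2" using p by (intro power_mono; simp)+
  define N where "N n = nat \<lfloor>(K - \<epsilon>) * real n\<rfloor>" for n :: nat
  have limN: "filterlim N at_top sequentially"
    unfolding N_def using True by (intro filterlim_nat_floor_mult) simp
  have "(K - \<epsilon>) * n \<le> ramsey_number (book (nat \<lceil>\<alpha> * real n\<rceil>)) (book n)"
    if good: "\<exists>c. \<forall>u<N n. \<forall>v<N n. u \<noteq> v \<longrightarrow>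
      card (common_nbrs (N n) c Red u v) \<le> (p\<^sup>2 + \<gamma>) * N n \<and>
      card (common_nbrs (N n) c Blue u v) \<le> ((1 - p)\<^sup>2 + \<gamma>) * N n" and n: "0 < n" for n :: nat
  proof (rule ccontr)
    define m where "m = nat \<lceil>\<alpha> * real n\<rceil>"
    assume "\<not> ?thesis"
    then have "ramsey_number (book m) (book n) \<le> N n"
      unfolding N_def m_def by linarith
    then have ramsey: "ramsey_property (book m) (book n) (N n)"
      using ramsey_property_book_mono ramsey_number_works[OF finite_simple_graph_book finite_simple_graph_book]
      by blast
    have Nn: "N n \<le> (K - \<epsilon>) * n" using True by (simp add: N_def)
    have few: "k < r * K * n" if r: "1 / 9 \<le> r" and k: "k \<le> (r + \<gamma>) * N n" for r k :: real
    proof -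
      have "k \<le> (r + \<gamma>) * ((K - \<epsilon>) * n)"
        using k r \<gamma> Nn mult_left_mono[of "N n" "(K - \<epsilon>) * n" "r + \<gamma>"] by linarith
      also have "\<dots> = (r + \<gamma>) * (K - \<epsilon>) * n" by simp
      also have "\<dots> < (r * K) * n"
      proof (rule mult_strict_right_mono)
        have "\<epsilon> * (1 / 9) \<le> \<epsilon> * r" "0 \<le> \<gamma> * \<epsilon>" using r \<epsilon> \<gamma> by (auto intro!: mult_left_mono)
        moreover have "(r + \<gamma>) * (K - \<epsilon>) = r * K + \<gamma> * K - \<epsilon> * r - \<gamma> * \<epsilon>" by algebra
        ultimately show "(r + \<gamma>) * (K - \<epsilon>) < r * K" using \<gamma>(2) \<epsilon> by linarith
      qed (use n in simp)
      finally show ?thesis .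
    qed
    obtain c where c: "\<And>u v. u < N n \<Longrightarrow> v < N n \<Longrightarrow> u \<noteq> v \<Longrightarrow>
        card (common_nbrs (N n) c Red u v) \<le> (p\<^sup>2 + \<gamma>) * N n \<and>
        card (common_nbrs (N n) c Blue u v) \<le> ((1 - p)\<^sup>2 + \<gamma>) * N n"
      using good by blast
    obtain u v where uv: "u < N n" "v < N n" "u \<noteq> v"
      and "m \<le> card (common_nbrs (N n) c Red u v) \<or> n \<le> card (common_nbrs (N n) c Blue u v)"
      using ramsey unfolding ramsey_property_book_iff by blast
    moreover have "card (common_nbrs (N n) c Red u v) < \<alpha> * n"
      using few[of "p\<^sup>2"] c[OF uv] p2 K by (simp add: power_divide)
    moreover have "card (common_nbrs (N n) c Blue u v) < 1 * n"
      using few[of "(1 - p)\<^sup>2" "card (common_nbrs (N n) c Blue u v)"] c[OF uv] p2 unfolding K(3)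
      by (simp add: power_divide)
    ultimately show False unfolding m_def by linarith
  qed
  note main = this
  have "eventually (\<lambda>n. \<exists>c. \<forall>u<N n. \<forall>v<N n. u \<noteq> v \<longrightarrow>
      card (common_nbrs (N n) c Red u v) \<le> (p\<^sup>2 + \<gamma>) * N n \<and>
      card (common_nbrs (N n) c Blue u v) \<le> ((1 - p)\<^sup>2 + \<gamma>) * N n) sequentially"
    using p \<gamma> by (intro eventually_compose_filterlim[OF exists_balanced_colouring limN]) auto
  with eventually_gt_at_top[of 0] show ?thesis by eventually_elim (rule main)
qed

theorem theorem1p4:
  fixes \<alpha> :: real
  assumes "1 / 4 \<le> \<alpha>" and "\<alpha> \<le> 1"
  shows "(\<lambda>n::nat. real (ramsey_number (book (nat \<lceil>\<alpha> * real n\<rceil>)) (book n))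
            - (sqrt \<alpha> + 1)\<^sup>2 * real n) \<in> o(\<lambda>n. real n)"
proof (rule landau_o.smallI)
  fix \<epsilon> :: real assume \<epsilon>: "0 < \<epsilon>"
  define s where "s = sqrt \<alpha>"
  \<comment> \<open>The red density at which random colourings meet both thresholds: \<open>p\<^sup>2 K =
    \<alpha>\<close> and \<open>(1 - p)\<^sup>2 K = 1\<close> for \<open>K = (s + 1)\<^sup>2\<close>.\<close>
  define p where "p = s / (s + 1)"
  have "sqrt (1 / 4) \<le> s" unfolding s_def using assms by (intro real_sqrt_le_mono)
  then have s: "1 / 2 \<le> s" "s \<le> 1" "s\<^sup>2 = \<alpha>"
    using assms by (auto simp: s_def real_sqrt_divide)
  have p: "1 / 3 \<le> p" "p \<le> 1 / 2" using s by (auto simp: p_def field_simps)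
  have K: "0 < (s + 1)\<^sup>2" "p\<^sup>2 * (s + 1)\<^sup>2 = \<alpha>" "(1 - p)\<^sup>2 * (s + 1)\<^sup>2 = 1"
  proof -
    have "p * (s + 1) = s" "(1 - p) * (s + 1) = 1" using s by (auto simp: p_def field_simps)
    then show "p\<^sup>2 * (s + 1)\<^sup>2 = \<alpha>" "(1 - p)\<^sup>2 * (s + 1)\<^sup>2 = 1"
      using s(3) by (simp_all flip: power_mult_distrib)
  qed (use s in auto)
  show "eventually (\<lambda>n. norm (real (ramsey_number (book (nat \<lceil>\<alpha> * real n\<rceil>)) (book n))
      - (sqrt \<alpha> + 1)\<^sup>2 * real n) \<le> \<epsilon> * norm (real n)) sequentially"
    using ramsey_number_book_upper[OF p K \<epsilon>] ramsey_number_book_lower[OF p K \<epsilon>]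
    unfolding s_def by eventually_elim (simp add: abs_le_iff algebra_simps)
qed

end
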